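(* Every definable Heyting algebra $(H,\sqsubseteq)$ with $\dim H=1$ is locally finite, i.e. every finite subset of $H$ generates a finite Heyting subalgebra.
   Context: Fix an o-minimal structure $R$ expanding a real-closed field. "Definable" means definable in $R$ with parameters; $\dim$ is o-minimal dimension. A Heyting algebra is a bounded distributive lattice $(H,\sqsubseteq)$ in which for all $x,y\in H$ the set $\{z\in H : x\sqcap z\sqsubseteq y\}$ has a maximum element, denoted $x\Rightarrow y$. It is definable if $H$ is a definable subset of some $R^n$ and $\sqsubseteq$ is a definable relation (the operations $\sqcap,\sqcup,\Rightarrow$ are then definable). Heyting subalgebras are closed under $\sqcap,\sqcup,\Rightarrow$ and contain $\bot,\top$. *)

theory Defs
  imports
    "HOL-Algebra.Lattice"
    "HOL-Library.Extended_Real"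
    "HOL-Computational_Algebra.Polynomial"
begin

section \<open>First-order structures expanding an ordered field\<close>

text \<open>
  The universe of the structure is an ordered field \<open>'a\<close>. The language extends that of ordered rings
  by arbitrary function symbols \<open>'f\<close> and relation symbols \<open>'r\<close>. Symbols are unranked: their
  interpretations \<open>F\<close> and \<open>P\<close> act on argument lists of every length, so one symbol stands for a family
  of symbols, one for each arity. Bound variables are de Bruijn indices.
\<close>

datatype 'f fo_term =
    Var nat
  | Zero
  | One
  | Minus "'f fo_term"
  | Plus "'f fo_term" "'f fo_term"
  | Times "'f fo_term" "'f fo_term"
  | Fun 'f "'f fo_term list"

datatype ('f, 'r) fo_formula =
    Eq "'f fo_term" "'f fo_term"
  | Less "'f fo_term" "'f fo_term"
  | Rel 'r "'f fo_term list"
  | Neg "('f, 'r) fo_formula"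
  | Conj "('f, 'r) fo_formula" "('f, 'r) fo_formula"
  | Ex "('f, 'r) fo_formula"

primrec term_val ::
  "('f \<Rightarrow> 'a list \<Rightarrow> 'a::linordered_field) \<Rightarrow> (nat \<Rightarrow> 'a) \<Rightarrow> 'f fo_term \<Rightarrow> 'a" where
  "term_val F e (Var i) = e i"
| "term_val F e Zero = 0"
| "term_val F e One = 1"
| "term_val F e (Minus s) = - term_val F e s"
| "term_val F e (Plus s t) = term_val F e s + term_val F e t"
| "term_val F e (Times s t) = term_val F e s * term_val F e t"
| "term_val F e (Fun f ts) = F f (map (term_val F e) ts)"

primrec sat ::
  "('f \<Rightarrow> 'a list \<Rightarrow> 'a::linordered_field) \<Rightarrow> ('r \<Rightarrow> 'a list \<Rightarrow> bool) \<Rightarrow>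
   (nat \<Rightarrow> 'a) \<Rightarrow> ('f, 'r) fo_formula \<Rightarrow> bool" where
  "sat F P e (Eq s t) \<longleftrightarrow> term_val F e s = term_val F e t"
| "sat F P e (Less s t) \<longleftrightarrow> term_val F e s < term_val F e t"
| "sat F P e (Rel r ts) \<longleftrightarrow> P r (map (term_val F e) ts)"
| "sat F P e (Neg \<phi>) \<longleftrightarrow> \<not> sat F P e \<phi>"
| "sat F P e (Conj \<phi> \<psi>) \<longleftrightarrow> sat F P e \<phi> \<and> sat F P e \<psi>"
| "sat F P e (Ex \<phi>) \<longleftrightarrow> (\<exists>x. sat F P (case_nat x e) \<phi>)"

text \<open>
  The space \<open>R\<^sup>n\<close> is rendered as the set of lists of length \<open>n\<close>. In \<open>tuple_env xs c\<close> the variables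
  below \<open>length xs\<close> denote the entries of \<open>xs\<close>; the remaining ones denote the parameters \<open>c\<close>,
  of which any formula mentions only finitely many.
\<close>

definition tuple_env :: "'a list \<Rightarrow> (nat \<Rightarrow> 'a) \<Rightarrow> nat \<Rightarrow> 'a" where
  "tuple_env xs c i = (if i < length xs then xs ! i else c (i - length xs))"

definition definable ::
  "('f \<Rightarrow> 'a list \<Rightarrow> 'a::linordered_field) \<Rightarrow> ('r \<Rightarrow> 'a list \<Rightarrow> bool) \<Rightarrow>
   nat \<Rightarrow> 'a list set \<Rightarrow> bool" where
  "definable F P n X \<longleftrightarrow>
     (\<exists>(\<phi> :: ('f, 'r) fo_formula) c. X = {xs. length xs = n \<and> sat F P (tuple_env xs c) \<phi>})"


section \<open>O-minimality and dimension\<close>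

definition real_closed :: "'a::linordered_field itself \<Rightarrow> bool" where
  "real_closed _ \<longleftrightarrow>
     (\<forall>x::'a. 0 \<le> x \<longrightarrow> (\<exists>y. y * y = x)) \<and>
     (\<forall>p::'a poly. odd (degree p) \<longrightarrow> (\<exists>x. poly p x = 0))"

definition open_interval :: "'a::linorder set \<Rightarrow> bool" where
  "open_interval I \<longleftrightarrow>
     I = UNIV \<or> (\<exists>a. I = {a<..}) \<or> (\<exists>b. I = {..<b}) \<or> (\<exists>a b. I = {a<..<b})"

definition o_minimal ::
  "('f \<Rightarrow> 'a list \<Rightarrow> 'a::linordered_field) \<Rightarrow> ('r \<Rightarrow> 'a list \<Rightarrow> bool) \<Rightarrow> bool" where
  "o_minimal F P \<longleftrightarrow>
     (\<forall>X. definable F P 1 X \<longrightarrow>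
       (\<exists>\<I>. finite \<I> \<and> (\<forall>I\<in>\<I>. (\<exists>a. I = {a}) \<or> open_interval I) \<and> {x. [x] \<in> X} = \<Union>\<I>))"

definition open_box :: "'a::linorder list \<Rightarrow> 'a list \<Rightarrow> 'a list set" where
  "open_box as bs =
     {xs. length xs = length as \<and> (\<forall>i<length as. as ! i < xs ! i \<and> xs ! i < bs ! i)}"

definition has_interior :: "nat \<Rightarrow> 'a::linorder list set \<Rightarrow> bool" where
  "has_interior d Y \<longleftrightarrow>
     (\<exists>as bs. length as = d \<and> length bs = d \<and> (\<forall>i<d. as ! i < bs ! i) \<and> open_box as bs \<subseteq> Y)"

definition coord_proj :: "nat list \<Rightarrow> 'a list \<Rightarrow> 'a list" where
  "coord_proj is xs = map (\<lambda>i. xs ! i) is"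

text \<open>
  The o-minimal dimension of \<open>X \<subseteq> R\<^sup>n\<close>: the largest \<open>d\<close> such that the projection of \<open>X\<close> onto some
  \<open>d\<close> of the coordinates has nonempty interior in \<open>R\<^sup>d\<close> (interval topology). The values are
  extended reals because \<open>dim \<emptyset> = -\<infinity>\<close>.
\<close>

definition o_dim :: "nat \<Rightarrow> 'a::linorder list set \<Rightarrow> ereal" where
  "o_dim n X =
     (SUP d \<in> {d. \<exists>is. length is = d \<and> sorted_wrt (<) is \<and> set is \<subseteq> {..<n} \<and>
                      has_interior d (coord_proj is ` X)}. ereal (real d))"


section \<open>Heyting algebras\<close>

locale heyting_algebra = bounded_lattice L for L (structure) +
  assumes meet_join_distrib:
      "\<lbrakk>x \<in> carrier L; y \<in> carrier L; z \<in> carrier L\<rbrakk>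
         \<Longrightarrow> x \<sqinter> (y \<squnion> z) = (x \<sqinter> y) \<squnion> (x \<sqinter> z)"
    and imp_exists:
      "\<lbrakk>x \<in> carrier L; y \<in> carrier L\<rbrakk>
         \<Longrightarrow> \<exists>m. greatest L m {z \<in> carrier L. x \<sqinter> z \<sqsubseteq> y}"

definition heyting_imp :: "('b, 'm) gorder_scheme \<Rightarrow> 'b \<Rightarrow> 'b \<Rightarrow> 'b" where
  "heyting_imp L x y = (THE m. greatest L m {z \<in> carrier L. x \<sqinter>\<^bsub>L\<^esub> z \<sqsubseteq>\<^bsub>L\<^esub> y})"

definition heyting_subalgebra :: "('b, 'm) gorder_scheme \<Rightarrow> 'b set \<Rightarrow> bool" where
  "heyting_subalgebra L A \<longleftrightarrow>
     A \<subseteq> carrier L \<and> \<bottom>\<^bsub>L\<^esub> \<in> A \<and> \<top>\<^bsub>L\<^esub> \<in> A \<and>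
     (\<forall>x\<in>A. \<forall>y\<in>A. x \<sqinter>\<^bsub>L\<^esub> y \<in> A \<and> x \<squnion>\<^bsub>L\<^esub> y \<in> A \<and> heyting_imp L x y \<in> A)"

definition generated_subalgebra :: "('b, 'm) gorder_scheme \<Rightarrow> 'b set \<Rightarrow> 'b set" where
  "generated_subalgebra L S = \<Inter>{A. heyting_subalgebra L A \<and> S \<subseteq> A}"

definition locally_finite :: "('b, 'm) gorder_scheme \<Rightarrow> bool" where
  "locally_finite L \<longleftrightarrow>
     (\<forall>S. finite S \<and> S \<subseteq> carrier L \<longrightarrow> finite (generated_subalgebra L S))"

definition definable_heyting_algebra ::
  "('f \<Rightarrow> 'a list \<Rightarrow> 'a::linordered_field) \<Rightarrow> ('r \<Rightarrow> 'a list \<Rightarrow> bool) \<Rightarrow>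
   nat \<Rightarrow> 'a list gorder \<Rightarrow> bool" where
  "definable_heyting_algebra F P n H \<longleftrightarrow>
     heyting_algebra H \<and>
     definable F P n (carrier H) \<and>
     definable F P (2 * n) {xs @ ys | xs ys. xs \<in> carrier H \<and> ys \<in> carrier H \<and> xs \<sqsubseteq>\<^bsub>H\<^esub> ys}"

end

theory Submission
  imports Defs
begin

text \<open>
  In dimension one no definable family of infinite subsets of \<open>H\<close> over an infinite index set can be
  point-finite: otherwise some coordinate projection of \<open>H\<close> to the plane would contain an open box.
  This yields two finiteness facts. First, the Boolean algebra \<open>{y \<rightharpoonup> x | y}\<close> is finite for
  every \<open>x\<close>: if it were infinite, the elements with finitely many predecessors would form an infinite
  directed definable set, whose up-sets are a point-finite family. Second, if \<open>y \<rightharpoonup> m = m\<close>,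
  then \<open>y \<rightharpoonup> x = m\<close> for all \<open>x\<close> between \<open>m \<sqinter> y\<close> and \<open>m\<close>; so only finitely many such \<open>m\<close>
  admit an infinite interval \<open>[m \<sqinter> y, m]\<close>.

  Call \<open>x\<close> and \<open>y\<close> near if the interval \<open>[x \<sqinter> y, x \<squnion> y]\<close> is finite. This is a lattice congruence with
  finite classes, and outside the finite exceptional set of values, \<open>y \<rightharpoonup> x\<close> is near \<open>x\<close>. Hence the
  elements near a finite sublattice containing the generators and the exceptional values form a finite
  Heyting subalgebra.
\<close>

section \<open>Definable predicates\<close>

text \<open>Cell decomposition and fibre dimension are avoided by working with two coordinates at a
  time: an infinite set of tuples takes infinitely many values in some coordinate, and a definable
  planar set with infinitely many infinite fibres contains a box (\<open>exists_open_box\<close>).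
  Dimension one enters only through \<open>finite_bad_coordinates\<close>: all but finitely many
  values of a coordinate are taken by finitely many elements of \<open>H\<close>. For an infinite
  family of infinite subsets, a box is sought not in a projection of \<open>H\<close> but among
  pairs (coordinate of an index, coordinate of a member). Fixing a second coordinate with finitely
  many elements over it leaves finitely many members to serve a whole interval of index coordinates,
  so one member lies in infinitely many sets.

  The two finiteness facts are linked: for exceptional \<open>m\<close> the sets
  \<open>{x. m \<in> regulars x}\<close> are infinite, and they form a point-finite family because
  each \<open>regulars x\<close> is finite. Nearness serves only as a lattice congruence;
  implication is controlled by its consequent alone, up to the exceptional values.\<close>

primrec rename_term :: "(nat \<Rightarrow> nat) \<Rightarrow> 'f fo_term \<Rightarrow> 'f fo_term" where
  "rename_term g (Var i) = Var (g i)"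
| "rename_term g Zero = Zero"
| "rename_term g One = One"
| "rename_term g (Minus s) = Minus (rename_term g s)"
| "rename_term g (Plus s t) = Plus (rename_term g s) (rename_term g t)"
| "rename_term g (Times s t) = Times (rename_term g s) (rename_term g t)"
| "rename_term g (Fun f ts) = Fun f (map (rename_term g) ts)"

lemma term_val_rename: "term_val F e (rename_term g t) = term_val F (\<lambda>i. e (g i)) t"
proof (induction t)
  case (Fun f ts)
  then have "map (term_val F e) (map (rename_term g) ts) = map (term_val F (\<lambda>i. e (g i))) ts"
    by simp
  then show ?case by (simp only: rename_term.simps term_val.simps)
qed auto

primrec rename_formula :: "(nat \<Rightarrow> nat) \<Rightarrow> ('f, 'r) fo_formula \<Rightarrow> ('f, 'r) fo_formula" where
  "rename_formula g (Eq s t) = Eq (rename_term g s) (rename_term g t)"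
| "rename_formula g (Less s t) = Less (rename_term g s) (rename_term g t)"
| "rename_formula g (Rel r ts) = Rel r (map (rename_term g) ts)"
| "rename_formula g (Neg \<phi>) = Neg (rename_formula g \<phi>)"
| "rename_formula g (Conj \<phi> \<psi>) = Conj (rename_formula g \<phi>) (rename_formula g \<psi>)"
| "rename_formula g (Ex \<phi>) = Ex (rename_formula (case_nat 0 (\<lambda>i. Suc (g i))) \<phi>)"

lemma sat_rename: "sat F P e (rename_formula g \<phi>) \<longleftrightarrow> sat F P (\<lambda>i. e (g i)) \<phi>"
proof (induction \<phi> arbitrary: e g)
  case (Rel r ts)
  have "map (term_val F e) (map (rename_term g) ts) = map (term_val F (\<lambda>i. e (g i))) ts"
    by (simp add: term_val_rename)
  then show ?case by (simp only: rename_formula.simps sat.simps)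
next
  case (Ex \<phi>)
  have "(\<lambda>i. case_nat x e (case_nat 0 (\<lambda>i. Suc (g i)) i)) = case_nat x (\<lambda>i. e (g i))" for x
    by (auto simp: fun_eq_iff split: nat.splits)
  then show ?case by (simp add: Ex)
qed (auto simp: term_val_rename)

locale definable_predicates =
  fixes F :: "'f \<Rightarrow> 'a list \<Rightarrow> 'a::linordered_field"
    and P :: "'r \<Rightarrow> 'a list \<Rightarrow> bool"
    and n :: nat
begin

text \<open>
  Environments consist of blocks \<open>e i\<close>, each standing for a vector (its coordinates \<open>0\<close> to \<open>n - 1\<close>) or
  for a scalar (its coordinate \<open>0\<close>, which is why coordinates up to \<open>n\<close> are allowed when \<open>n = 0\<close>).
\<close>

definition coords :: "((nat \<Rightarrow> nat \<Rightarrow> 'a) \<Rightarrow> 'a) set" where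
  "coords = {s. (\<exists>i j. j \<le> n \<and> s = (\<lambda>e. e i j)) \<or> (\<exists>c. s = (\<lambda>_. c))}"

text \<open>The variables of the formula are assigned to coordinates or constants by an arbitrary
  \<open>r\<close>. Parameters thus need no separate treatment, and substituting coordinates or
  constants for coordinates changes only \<open>r\<close>, never the formula.\<close>

definition dfn :: "((nat \<Rightarrow> nat \<Rightarrow> 'a) \<Rightarrow> bool) \<Rightarrow> bool" where
  "dfn Q \<longleftrightarrow> (\<exists>(\<phi> :: ('f, 'r) fo_formula) r. range r \<subseteq> coords \<and> (\<forall>e. Q e \<longleftrightarrow> sat F P (\<lambda>k. r k e) \<phi>))"

definition dfn_term :: "((nat \<Rightarrow> nat \<Rightarrow> 'a) \<Rightarrow> 'a) \<Rightarrow> bool" where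
  "dfn_term t \<longleftrightarrow> (\<exists>\<tau> r. range r \<subseteq> coords \<and> (\<forall>e. t e = term_val F (\<lambda>k. r k e) \<tau>))"

lemma coords_var [simp]: "j \<le> n \<Longrightarrow> (\<lambda>e. e i j) \<in> coords"
  and coords_const [simp]: "(\<lambda>e. c) \<in> coords"
  by (auto simp: coords_def)

lemma coords_if: "(b \<Longrightarrow> s \<in> coords) \<Longrightarrow> (\<not> b \<Longrightarrow> t \<in> coords) \<Longrightarrow> (\<lambda>e. if b then s e else t e) \<in> coords"
  by (cases b) simp_all

lemma coords_case_nat: "j \<le> n \<Longrightarrow> (\<lambda>e. case_nat (\<lambda>_. c) e i j) \<in> coords"
  by (cases i) simp_all

lemma dfnI: "(\<And>k. r k \<in> coords) \<Longrightarrow> (\<And>e. Q e \<longleftrightarrow> sat F P (\<lambda>k. r k e) \<phi>) \<Longrightarrow> dfn Q"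
  unfolding dfn_def by blast

lemma dfnE:
  assumes "dfn Q"
  obtains \<phi> r where "\<And>k. r k \<in> coords" "Q = (\<lambda>e. sat F P (\<lambda>k. r k e) \<phi>)"
  using assms unfolding dfn_def by blast

lemma dfn_termE:
  assumes "dfn_term t"
  obtains \<tau> r where "\<And>k. r k \<in> coords" "t = (\<lambda>e. term_val F (\<lambda>k. r k e) \<tau>)"
  using assms unfolding dfn_term_def by blast

text \<open>Interleaving two assignments lets two formulas, renamed to even and to odd variables, be
  combined without a clash of variables.\<close>

definition merge :: "(nat \<Rightarrow> 'b) \<Rightarrow> (nat \<Rightarrow> 'b) \<Rightarrow> nat \<Rightarrow> 'b" where
  "merge r r' k = (if even k then r (k div 2) else r' (k div 2))"

lemma merge_in: "(\<And>k. r k \<in> A) \<Longrightarrow> (\<And>k. r' k \<in> A) \<Longrightarrow> merge r r' k \<in> A"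
  by (simp add: merge_def)

lemma merge_rename:
  "(\<lambda>k. merge r r' (2 * k) e) = (\<lambda>k. r k e)"
  "(\<lambda>k. merge r r' (Suc (2 * k)) e) = (\<lambda>k. r' k e)"
  by (auto simp: merge_def)

section \<open>Closure under connectives, terms, substitution and quantifiers\<close>

lemma dfn_not: "dfn Q \<Longrightarrow> dfn (\<lambda>e. \<not> Q e)"
  by (elim dfnE) (rule dfnI[where \<phi> = "Neg _"], auto)

lemma dfn_conj:
  assumes "dfn Q" "dfn Q'"
  shows "dfn (\<lambda>e. Q e \<and> Q' e)"
proof -
  obtain \<phi> r \<psi> r' where *: "\<And>k. r k \<in> coords" "Q = (\<lambda>e. sat F P (\<lambda>k. r k e) \<phi>)"
    "\<And>k. r' k \<in> coords" "Q' = (\<lambda>e. sat F P (\<lambda>k. r' k e) \<psi>)"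
    using assms by (metis dfnE)
  show ?thesis
    by (rule dfnI[where r = "merge r r'" and
          \<phi> = "Conj (rename_formula (\<lambda>k. 2 * k) \<phi>) (rename_formula (\<lambda>k. Suc (2 * k)) \<psi>)"])
      (simp_all add: * merge_in sat_rename merge_rename)
qed

lemma dfn_term_coord:
  assumes "s \<in> coords"
  shows "dfn_term s"
  unfolding dfn_term_def
  by (rule exI[of _ "Var 0"], rule exI[of _ "\<lambda>_. s"]) (use assms in auto)

lemma dfn_term_plus:
  assumes "dfn_term s" "dfn_term t"
  shows "dfn_term (\<lambda>e. s e + t e)"
proof -
  obtain \<sigma> r \<tau> r' where *: "\<And>k. r k \<in> coords" "s = (\<lambda>e. term_val F (\<lambda>k. r k e) \<sigma>)"
    "\<And>k. r' k \<in> coords" "t = (\<lambda>e. term_val F (\<lambda>k. r' k e) \<tau>)"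
    using assms by (metis dfn_termE)
  have "range (merge r r') \<subseteq> coords" using * by (auto intro: merge_in)
  moreover have "s e + t e = term_val F (\<lambda>k. merge r r' k e)
      (Plus (rename_term (\<lambda>k. 2 * k) \<sigma>) (rename_term (\<lambda>k. Suc (2 * k)) \<tau>))" for e
    by (simp add: * term_val_rename merge_rename)
  ultimately show ?thesis unfolding dfn_term_def by blast
qed

lemma
  assumes "dfn_term s" "dfn_term t"
  shows dfn_less: "dfn (\<lambda>e. s e < t e)" and dfn_eq: "dfn (\<lambda>e. s e = t e)"
proof -
  obtain \<sigma> r \<tau> r' where *: "\<And>k. r k \<in> coords" "s = (\<lambda>e. term_val F (\<lambda>k. r k e) \<sigma>)"
    "\<And>k. r' k \<in> coords" "t = (\<lambda>e. term_val F (\<lambda>k. r' k e) \<tau>)"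
    using assms by (metis dfn_termE)
  show "dfn (\<lambda>e. s e < t e)"
    by (rule dfnI[where r = "merge r r'" and
          \<phi> = "Less (rename_term (\<lambda>k. 2 * k) \<sigma>) (rename_term (\<lambda>k. Suc (2 * k)) \<tau>)"])
      (simp_all add: * merge_in term_val_rename merge_rename)
  show "dfn (\<lambda>e. s e = t e)"
    by (rule dfnI[where r = "merge r r'" and
          \<phi> = "Eq (rename_term (\<lambda>k. 2 * k) \<sigma>) (rename_term (\<lambda>k. Suc (2 * k)) \<tau>)"])
      (simp_all add: * merge_in term_val_rename merge_rename)
qed

lemma dfn_const: "dfn (\<lambda>e. b)"
  using dfn_eq[OF dfn_term_coord dfn_term_coord, of "\<lambda>_. 0" "\<lambda>_. if b then 0 else 1"]
  by (cases b) simp_all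

lemma dfn_disj: "dfn Q \<Longrightarrow> dfn Q' \<Longrightarrow> dfn (\<lambda>e. Q e \<or> Q' e)"
  using dfn_not[OF dfn_conj[OF dfn_not dfn_not], of Q Q'] by simp

lemma dfn_imp: "dfn Q \<Longrightarrow> dfn Q' \<Longrightarrow> dfn (\<lambda>e. Q e \<longrightarrow> Q' e)"
  using dfn_disj[OF dfn_not, of Q Q'] by simp

lemma dfn_iff: "dfn Q \<Longrightarrow> dfn Q' \<Longrightarrow> dfn (\<lambda>e. Q e \<longleftrightarrow> Q' e)"
  using dfn_conj[OF dfn_imp dfn_imp, of Q Q' Q' Q] by (simp add: iff_conv_conj_imp)

lemma dfn_bex_finite:
  "finite J \<Longrightarrow> (\<And>j. j \<in> J \<Longrightarrow> dfn (Q j)) \<Longrightarrow> dfn (\<lambda>e. \<exists>j\<in>J. Q j e)"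
  by (induction rule: finite_induct) (simp_all add: dfn_const dfn_disj)

lemma coords_subst:
  assumes "\<And>i j. j \<le> n \<Longrightarrow> (\<lambda>e. \<sigma> e i j) \<in> coords" "s \<in> coords"
  shows "(\<lambda>e. s (\<sigma> e)) \<in> coords"
proof -
  consider i j where "j \<le> n" "s = (\<lambda>e. e i j)" | c where "s = (\<lambda>_. c)"
    using assms(2) unfolding coords_def by blast
  then show ?thesis by cases (use assms(1) in simp_all)
qed

lemma dfn_subst:
  assumes "\<And>i j. j \<le> n \<Longrightarrow> (\<lambda>e. \<sigma> e i j) \<in> coords" "dfn Q"
  shows "dfn (\<lambda>e. Q (\<sigma> e))"
  using assms(2) by (elim dfnE) (rule dfnI, rule coords_subst[OF assms(1)], auto)

lemma dfn_cong_env: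
  assumes "dfn Q" "\<And>i j. j \<le> n \<Longrightarrow> e i j = e' i j"
  shows "Q e = Q e'"
proof -
  obtain \<phi> r where *: "\<And>k. r k \<in> coords" "Q = (\<lambda>e. sat F P (\<lambda>k. r k e) \<phi>)"
    using assms(1) by (metis dfnE)
  have "r k e = r k e'" for k using *(1)[of k] assms(2) by (auto simp: coords_def)
  then show ?thesis using * by simp
qed

lemma dfn_ex_coord:
  assumes "dfn Q"
  shows "dfn (\<lambda>e. \<exists>x. Q (e(i := (e i)(j := x))))"
proof -
  obtain \<phi> r where *: "\<And>k. r k \<in> coords" "Q = (\<lambda>e. sat F P (\<lambda>k. r k e) \<phi>)"
    using assms(1) by (metis dfnE)
  \<comment> \<open>Several variables of \<open>\<phi>\<close> may read coordinate \<open>j\<close>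
    of block \<open>i\<close>, so all of them are sent to the bound variable; the others do not see
    the update.\<close>
  let ?g = "\<lambda>k. if r k = (\<lambda>e. e i j) then 0 else Suc k"
  have "(\<lambda>k. case_nat x (\<lambda>k. r k e) (?g k)) = (\<lambda>k. r k (e(i := (e i)(j := x))))" for x e
  proof
    fix k show "case_nat x (\<lambda>k. r k e) (?g k) = r k (e(i := (e i)(j := x)))"
      using *(1)[of k] by (auto simp: coords_def)
  qed
  then show ?thesis
    by (intro dfnI[where r = r and \<phi> = "Ex (rename_formula ?g \<phi>)"]) (simp_all add: * sat_rename)
qed

text \<open>A block has infinitely many entries, but a definable predicate reads only those up to
  \<open>n\<close>, so finitely many quantifiers over single coordinates suffice.\<close>

lemma dfn_ex_block:
  assumes "dfn (\<lambda>e. Q (e 0) (\<lambda>i. e (Suc i)))"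
  shows "dfn (\<lambda>e. \<exists>h. Q h e)"
proof -
  let ?B = "\<lambda>e. Q (e 0) (\<lambda>i. e (Suc i))"
  have *: "dfn (\<lambda>e. \<exists>h. ?B (e(0 := (\<lambda>j. if j < m then h j else e 0 j))))" for m
  proof (induction m)
    case 0
    then show ?case using assms by simp
  next
    case (Suc m)
    have "(\<exists>x h. ?B ((e(0 := (e 0)(m := x)))(0 := (\<lambda>j. if j < m then h j else (e(0 := (e 0)(m := x))) 0 j))))
        \<longleftrightarrow> (\<exists>h. ?B (e(0 := (\<lambda>j. if j < Suc m then h j else e 0 j))))" (is "?l \<longleftrightarrow> ?r") for e
    proof
      assume ?l
      then obtain x h where "?B ((e(0 := (e 0)(m := x)))(0 := (\<lambda>j. if j < m then h j else (e(0 := (e 0)(m := x))) 0 j)))"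
        by blast
      moreover have "(\<lambda>j. if j < m then h j else (e(0 := (e 0)(m := x))) 0 j) =
          (\<lambda>j. if j < Suc m then (h(m := x)) j else e 0 j)" by (auto simp: less_Suc_eq)
      ultimately show ?r by (intro exI[of _ "h(m := x)"]) simp
    next
      assume ?r
      then obtain h where "?B (e(0 := (\<lambda>j. if j < Suc m then h j else e 0 j)))" by blast
      moreover have "(\<lambda>j. if j < m then h j else (e(0 := (e 0)(m := h m))) 0 j) =
          (\<lambda>j. if j < Suc m then h j else e 0 j)" by (auto simp: less_Suc_eq)
      ultimately show ?l by (intro exI[of _ "h m"] exI[of _ h]) simp
    qed
    then show ?case using dfn_ex_coord[OF Suc, of 0 m] by simp
  qed
  \<comment> \<open>With \<open>m = Suc n\<close> every readable entry of block 0 is overwritten, so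
    the zero block inserted by \<open>case_nat\<close> leaves no trace.\<close>
  have "dfn (\<lambda>e. \<exists>h. ?B ((case_nat (\<lambda>_. 0) e)(0 := (\<lambda>j. if j < Suc n then h j else (case_nat (\<lambda>_. 0) e) 0 j))))"
    by (rule dfn_subst[OF _ *[of "Suc n"]]) (simp_all add: coords_case_nat)
  moreover have "?B ((case_nat (\<lambda>_. 0) e)(0 := (\<lambda>j. if j < Suc n then h j else (case_nat (\<lambda>_. 0) e) 0 j)))
     \<longleftrightarrow> ?B (case_nat h e)" for h e
    by (rule dfn_cong_env[OF assms]) (auto split: nat.split)
  ultimately show ?thesis by simp
qed

lemma dfn_ex:
  assumes "dfn (\<lambda>e. Q (e 0 0) (\<lambda>i. e (Suc i)))"
  shows "dfn (\<lambda>e. \<exists>x. Q x e)"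
proof -
  have "(\<exists>h :: nat \<Rightarrow> 'a. Q (h 0) e) \<longleftrightarrow> (\<exists>x. Q x e)" for e
    by (auto intro: exI[of _ "\<lambda>_. _"])
  then show ?thesis using dfn_ex_block[of "\<lambda>h. Q (h 0)"] assms by simp
qed

lemma dfn_all:
  assumes "dfn (\<lambda>e. Q (e 0 0) (\<lambda>i. e (Suc i)))"
  shows "dfn (\<lambda>e. \<forall>x. Q x e)"
  using dfn_not[OF dfn_ex[OF dfn_not[OF assms]]] by simp

section \<open>Tuples as blocks, and the link with \<open>definable\<close>\<close>

definition block :: "(nat \<Rightarrow> 'a) \<Rightarrow> 'a list" where
  "block h = map h [0..<n]"

lemma length_block [simp]: "length (block h) = n"
  and nth_block [simp]: "j < n \<Longrightarrow> block h ! j = h j"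
  by (simp_all add: block_def)

lemma block_nth: "length xs = n \<Longrightarrow> block ((!) xs) = xs"
  by (intro nth_equalityI) simp_all

definition vec_term :: "((nat \<Rightarrow> nat \<Rightarrow> 'a) \<Rightarrow> 'a list) \<Rightarrow> bool" where
  "vec_term t \<longleftrightarrow> (\<forall>e. length (t e) = n) \<and> (\<forall>j<n. (\<lambda>e. t e ! j) \<in> coords)"

lemma vec_term_block: "vec_term (\<lambda>e. block (e i))"
  by (auto simp: vec_term_def)

lemma vec_term_const: "length xs = n \<Longrightarrow> vec_term (\<lambda>e. xs)"
  by (auto simp: vec_term_def)

lemma dfn_term_nth: "vec_term t \<Longrightarrow> j < n \<Longrightarrow> dfn_term (\<lambda>e. t e ! j)"
  by (auto simp: vec_term_def intro: dfn_term_coord)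

lemma dfn_ex_vec:
  assumes "dfn (\<lambda>e. Q (block (e 0)) (\<lambda>i. e (Suc i)))"
  shows "dfn (\<lambda>e. \<exists>x. length x = n \<and> Q x e)"
proof -
  have "(\<exists>h. Q (block h) e) \<longleftrightarrow> (\<exists>x. length x = n \<and> Q x e)" for e
    by (metis block_nth length_block)
  then show ?thesis using dfn_ex_block[of "\<lambda>h. Q (block h)"] assms by simp
qed

lemma dfn_definable:
  assumes "definable F P n X" "vec_term t"
  shows "dfn (\<lambda>e. t e \<in> X)"
proof -
  obtain \<phi> :: "('f, 'r) fo_formula" and c
    where X: "X = {xs. length xs = n \<and> sat F P (tuple_env xs c) \<phi>}"
    using assms(1) by (auto simp: definable_def)
  let ?r = "\<lambda>k e. if k < n then t e ! k else c (k - n)"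
  have len: "length (t e) = n" for e using assms(2) by (simp add: vec_term_def)
  have "tuple_env (t e) c = (\<lambda>k. ?r k e)" for e by (auto simp: len tuple_env_def)
  then show ?thesis
    by (intro dfnI[where r = ?r and \<phi> = \<phi>])
      (use assms(2) in \<open>auto simp: X len vec_term_def intro!: coords_if\<close>)
qed

lemma dfn_definable_rel:
  assumes "definable F P (2 * n) {xs @ ys | xs ys. xs \<in> X \<and> ys \<in> X \<and> R xs ys}" 
    and "\<And>x. x \<in> X \<Longrightarrow> length x = n" "vec_term s" "vec_term t"
  shows "dfn (\<lambda>e. s e \<in> X \<and> t e \<in> X \<and> R (s e) (t e))"
proof -
  obtain \<phi> :: "('f, 'r) fo_formula" and c
    where X: "{xs @ ys | xs ys. xs \<in> X \<and> ys \<in> X \<and> R xs ys} =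
      {xs. length xs = 2 * n \<and> sat F P (tuple_env xs c) \<phi>}"
    using assms(1) by (auto simp: definable_def)
  let ?r = "\<lambda>k e. if k < n then s e ! k else if k < 2 * n then t e ! (k - n) else c (k - 2 * n)"
  have len: "length (s e) = n" "length (t e) = n" for e
    using assms(3,4) by (simp_all add: vec_term_def)
  \<comment> \<open>Both halves have length \<open>n\<close>, so the concatenation determines
    them.\<close>
  have *: "s e \<in> X \<and> t e \<in> X \<and> R (s e) (t e) \<longleftrightarrow> s e @ t e \<in> {xs @ ys | xs ys. xs \<in> X \<and> ys \<in> X \<and> R xs ys}" for e
    using assms(2) len by auto
  have "tuple_env (s e @ t e) c = (\<lambda>k. ?r k e)" for e
    by (auto simp: len tuple_env_def nth_append fun_eq_iff mult_2)
  then show ?thesis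
    unfolding * X
    by (intro dfnI[where r = ?r and \<phi> = \<phi>])
      (use assms(3,4) in \<open>auto simp: len vec_term_def intro!: coords_if\<close>)
qed

lemma dfn_subst1:
  assumes "dfn (\<lambda>e. X (e 0 0))" "s \<in> coords"
  shows "dfn (\<lambda>e. X (s e))"
  using dfn_subst[where \<sigma> = "\<lambda>e i j. s e", OF _ assms(1)] assms(2) by simp

lemma dfn_subst2:
  assumes "dfn (\<lambda>e. X (e 0 0) (e 1 0))" "s \<in> coords" "t \<in> coords"
  shows "dfn (\<lambda>e. X (s e) (t e))"
  using dfn_subst[where \<sigma> = "\<lambda>e i j. if i = 0 then s e else t e", OF _ assms(1)] assms(2,3)
  by (simp add: coords_if)

lemma dfn_subst_vec3:
  assumes "dfn (\<lambda>e. X (block (e 0)) (block (e 1)) (block (e 2)))" "vec_term s" "vec_term t" "vec_term u"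
  shows "dfn (\<lambda>e. X (s e) (t e) (u e))"
proof -
  let ?\<sigma> = "\<lambda>e (i :: nat) j. if j < n then if i = 0 then s e ! j else if i = 1 then t e ! j else u e ! j else 0"
  have "dfn (\<lambda>e. (\<lambda>e. X (block (e 0)) (block (e 1)) (block (e 2))) (?\<sigma> e))"
    by (rule dfn_subst[where \<sigma> = ?\<sigma>, OF _ assms(1)])
      (use assms(2-4) in \<open>auto simp: vec_term_def intro!: coords_if\<close>)
  moreover have "block (?\<sigma> e 0) = s e" "block (?\<sigma> e 1) = t e" "block (?\<sigma> e 2) = u e" for e
    using assms(2-4) by (auto simp: vec_term_def block_def intro!: nth_equalityI)
  ultimately show ?thesis by simp
qed

lemma dfn_subst_vec2:
  assumes "dfn (\<lambda>e. X (block (e 0)) (block (e 1)))" "vec_term s" "vec_term t"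
  shows "dfn (\<lambda>e. X (s e) (t e))"
  using dfn_subst_vec3[where X = "\<lambda>x y z. X x y", OF _ assms(2,3,3)] assms(1) by simp

end

section \<open>Open boxes in definable subsets of the plane\<close>

text \<open>Describing the supremum by its upper bounds makes the supremum of a union the
  \<open>max\<close> of the two suprema. In an ordered field the empty set has none, whence the
  nonemptiness conditions below.\<close>

definition has_lub :: "'a::linorder set \<Rightarrow> bool" where
  "has_lub X \<longleftrightarrow> (\<exists>s. \<forall>b. (\<forall>x\<in>X. x \<le> b) \<longleftrightarrow> s \<le> b)"

lemma has_lub_Un:
  assumes "has_lub X" "has_lub Y"
  shows "has_lub (X \<union> Y)"
proof -
  obtain s t where "\<And>b. (\<forall>x\<in>X. x \<le> b) \<longleftrightarrow> s \<le> b" "\<And>b. (\<forall>x\<in>Y. x \<le> b) \<longleftrightarrow> t \<le> b"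
    using assms unfolding has_lub_def by blast
  then have "(\<forall>x\<in>X \<union> Y. x \<le> b) \<longleftrightarrow> max s t \<le> b" for b by auto
  then show ?thesis unfolding has_lub_def by blast
qed

lemma has_lub_open_interval:
  fixes I :: "'a::linordered_field set"
  assumes "open_interval I" "\<forall>x\<in>I. x \<le> b" "I \<noteq> {}"
  shows "has_lub I"
proof -
  have unbounded: "\<not> (\<forall>x>a. x \<le> b)" for a
    using gt_ex[of "max a b"] by (metis leD max_less_iff_conj)
  from assms(1) consider "I = UNIV" | a where "I = {a<..}" | c where "I = {..<c}"
    | a c where "I = {a<..<c}"
    unfolding open_interval_def by blast
  then show ?thesis
  proof cases
    case 1
    then show ?thesis using assms(2) unbounded by simp
  next
    case (2 a)
    then show ?thesis using assms(2) unbounded[of a] by auto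
  next
    case (3 c)
    have "(\<forall>x\<in>I. x \<le> d) \<longleftrightarrow> c \<le> d" for d
      using 3 dense[of d c] by (fastforce simp: not_le[symmetric])
    then show ?thesis unfolding has_lub_def by blast
  next
    case (4 a c)
    then have "a < c" using assms(3) by auto
    have "(\<forall>x\<in>I. x \<le> d) \<longleftrightarrow> c \<le> d" for d
    proof
      assume *: "\<forall>x\<in>I. x \<le> d"
      show "c \<le> d"
      proof (rule ccontr)
        assume "\<not> c \<le> d"
        then obtain x where "max a d < x" "x < c" using dense[of "max a d" c] \<open>a < c\<close> by auto
        then show False using * 4 by (auto dest!: bspec[of _ _ x])
      qed
    qed (use 4 in auto)
    then show ?thesis unfolding has_lub_def by blast
  qed
qed

text \<open>The topological boundary for the order topology, spelled out with first-order
  quantifiers so that boundaries of a definable family are again a definable family.\<close>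

definition bdry :: "'a::linorder set \<Rightarrow> 'a set" where
  "bdry X = {x. \<forall>a b. a < x \<and> x < b \<longrightarrow> (\<exists>y. a < y \<and> y < b \<and> y \<in> X) \<and> (\<exists>y. a < y \<and> y < b \<and> y \<notin> X)}"

lemma bdry_Compl: "bdry (- X) = bdry X"
  by (auto simp: bdry_def)

locale ominimal = definable_predicates F P n
  for F :: "'f \<Rightarrow> 'a list \<Rightarrow> 'a::linordered_field"
    and P :: "'r \<Rightarrow> 'a list \<Rightarrow> bool"
    and n :: nat +
  assumes o_minimal: "o_minimal F P"
begin

section \<open>Consequences of o-minimality in one variable\<close>

lemma dfn_union_of_intervals:
  assumes "dfn (\<lambda>e. Q (e 0 0))"
  obtains \<I> where "finite \<I>" "\<forall>I\<in>\<I>. (\<exists>a. I = {a}) \<or> open_interval I" "{x. Q x} = \<Union>\<I>"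
proof -
  obtain \<phi> r where *: "\<And>k. r k \<in> coords" "(\<lambda>e. Q (e 0 0)) = (\<lambda>e. sat F P (\<lambda>k. r k e) \<phi>)"
    using assms by (metis dfnE)
  \<comment> \<open>The predicate depends on a single coordinate. All others are frozen at 0, so
    that the variables reading them become parameters.\<close>
  let ?z = "\<lambda>x i j. if i = 0 \<and> j = 0 then x else 0"
  let ?g = "\<lambda>k. if r k = (\<lambda>e. e 0 0) then 0 else Suc k"
  define c where "c k = r k (?z 0)" for k
  have "tuple_env [x] c (?g k) = r k (?z x)" for x k
    using *(1)[of k] by (auto simp: tuple_env_def c_def coords_def)
  then have "sat F P (tuple_env [x] c) (rename_formula ?g \<phi>) \<longleftrightarrow> sat F P (\<lambda>k. r k (?z x)) \<phi>" for x
    by (simp add: sat_rename)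
  also have "\<dots> x \<longleftrightarrow> Q x" for x
    using fun_cong[OF *(2), of "?z x"] by simp
  finally have sat: "sat F P (tuple_env [x] c) (rename_formula ?g \<phi>) \<longleftrightarrow> Q x" for x .
  let ?X = "{xs. length xs = 1 \<and> sat F P (tuple_env xs c) (rename_formula ?g \<phi>)}"
  have "definable F P 1 ?X" unfolding definable_def by (intro exI) (rule refl)
  with o_minimal have "\<exists>\<I>. finite \<I> \<and> (\<forall>I\<in>\<I>. (\<exists>a. I = {a}) \<or> open_interval I) \<and> {x. [x] \<in> ?X} = \<Union>\<I>"
    by (simp only: o_minimal_def)
  then obtain \<I> where "finite \<I>" "\<forall>I\<in>\<I>. (\<exists>a. I = {a}) \<or> open_interval I" "{x. [x] \<in> ?X} = \<Union>\<I>"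
    by (elim exE conjE)
  moreover have "{x. [x] \<in> ?X} = {x. Q x}" by (simp add: sat)
  ultimately show ?thesis using that by simp
qed

lemma dfn_infinite_imp_interval:
  assumes "dfn (\<lambda>e. Q (e 0 0))" "infinite {x. Q x}"
  shows "\<exists>a b. a < b \<and> (\<forall>x. a < x \<and> x < b \<longrightarrow> Q x)"
proof -
  obtain \<I> where I: "finite \<I>" "\<forall>I\<in>\<I>. (\<exists>a. I = {a}) \<or> open_interval I" "{x. Q x} = \<Union>\<I>"
    using dfn_union_of_intervals[OF assms(1)] by blast
  then obtain I where "I \<in> \<I>" "infinite I" using assms(2) finite_Union[of \<I>] by auto
  then have "open_interval I" using I(2) by force
  then consider "I = UNIV" | a where "I = {a<..}" | c where "I = {..<c}" | a c where "I = {a<..<c}"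
    unfolding open_interval_def by blast
  then have "\<exists>a b. a < b \<and> {a<..<b} \<subseteq> I"
  proof cases
    case 1
    then show ?thesis using gt_ex by blast
  next
    case (2 a)
    obtain b where "a < b" using gt_ex by blast
    then show ?thesis using 2 by (intro exI[of _ a] exI[of _ b]) auto
  next
    case (3 c)
    obtain b where "b < c" using lt_ex by blast
    then show ?thesis using 3 by (intro exI[of _ b] exI[of _ c]) auto
  next
    case (4 a c)
    then have "a < c" using \<open>infinite I\<close> by (metis finite.emptyI greaterThanLessThan_empty not_le)
    then show ?thesis using 4 by blast
  qed
  then show ?thesis using \<open>I \<in> \<I>\<close> I(3) by fastforce
qed

text \<open>The right-hand side is first-order. Infinitude of fibres is therefore definable in
  families, with no uniform bound on the number of intervals.\<close>

lemma dfn_infinite_iff: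
  assumes "dfn (\<lambda>e. Q (e 0 0))"
  shows "infinite {x. Q x} \<longleftrightarrow> (\<exists>a b. a < b \<and> (\<forall>x. a < x \<and> x < b \<longrightarrow> Q x))"
proof
  assume "\<exists>a b. a < b \<and> (\<forall>x. a < x \<and> x < b \<longrightarrow> Q x)"
  then obtain a b where "a < b" "\<forall>x. a < x \<and> x < b \<longrightarrow> Q x" by blast
  moreover from this have "{a<..<b} \<subseteq> {x. Q x}" by auto
  ultimately show "infinite {x. Q x}" using infinite_Ioo infinite_super by blast
qed (rule dfn_infinite_imp_interval[OF assms])

text \<open>Definable completeness, the substitute for order completeness of the field: a bounded
  finite union of points and intervals has a supremum.\<close>

lemma dfn_has_lub:
  assumes "dfn (\<lambda>e. Q (e 0 0))" "Q x" "\<And>x. Q x \<Longrightarrow> x \<le> b"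
  shows "has_lub {x. Q x}"
proof -
  obtain \<I> where I: "finite \<I>" "\<forall>I\<in>\<I>. (\<exists>a. I = {a}) \<or> open_interval I" "{x. Q x} = \<Union>\<I>"
    using dfn_union_of_intervals[OF assms(1)] by blast
  have lub: "has_lub I" if "I \<in> \<I>" "I \<noteq> {}" for I
  proof (cases "\<exists>a. I = {a}")
    case True
    then show ?thesis by (auto simp: has_lub_def)
  next
    case False
    then show ?thesis using I that assms(3) by (intro has_lub_open_interval[of _ b]) auto
  qed
  have "\<J> \<subseteq> \<I> \<Longrightarrow> finite \<J> \<Longrightarrow> \<Union>\<J> = {} \<or> has_lub (\<Union>\<J>)" for \<J>
  proof (induction \<J> rule: infinite_finite_induct)
    case (insert J \<J>)
    then have "J = {} \<or> has_lub J" "\<Union>\<J> = {} \<or> has_lub (\<Union>\<J>)" using lub[of J] by auto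
    then show ?case
      using has_lub_Un[of J "\<Union>\<J>"] by (metis Union_insert sup_bot.left_neutral sup_bot.right_neutral)
  qed auto
  from this[of \<I>] I show ?thesis using assms(2) by auto
qed

lemmas dfn_rules = dfn_not dfn_conj dfn_disj dfn_imp dfn_iff dfn_less dfn_eq dfn_ex dfn_all
  dfn_term_plus dfn_term_coord coords_var coords_const

lemma dfn_bdry:
  assumes "dfn (\<lambda>e. X (e 0 0) (e 1 0))" "s \<in> coords" "t \<in> coords"
  shows "dfn (\<lambda>e. t e \<in> bdry {v. X (s e) v})"
proof -
  have "dfn (\<lambda>e. e 1 0 \<in> bdry {v. X (e 0 0) v})"
    unfolding bdry_def mem_Collect_eq by (intro dfn_rules dfn_subst2[OF assms(1)]) auto
  then show ?thesis by (rule dfn_subst2[OF _ assms(2,3)])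
qed

text \<open>An interval of boundary points would meet \<open>Q\<close> or its complement in an
  infinite definable set, hence in a subinterval, and points inside such a subinterval are not
  boundary points.\<close>

lemma finite_bdry:
  assumes "dfn (\<lambda>e. Q (e 0 0))"
  shows "finite (bdry {x. Q x})"
proof (rule ccontr)
  assume "infinite (bdry {x. Q x})"
  moreover have "dfn (\<lambda>e. e 0 0 \<in> bdry {x. Q x})"
    by (rule dfn_bdry[where X = "\<lambda>_. Q" and s = "\<lambda>_. 0"]) (auto intro: dfn_subst1[OF assms])
  ultimately obtain a b where ab: "a < b" "\<And>x. a < x \<Longrightarrow> x < b \<Longrightarrow> x \<in> bdry {x. Q x}"
    using dfn_infinite_imp_interval[of "\<lambda>x. x \<in> bdry {x. Q x}"] by (auto simp del: mem_Collect_eq)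
  have no_interval: False if R: "dfn (\<lambda>e. R (e 0 0))" "infinite {x. a < x \<and> x < b \<and> R x}"
    "R = Q \<or> R = (\<lambda>x. \<not> Q x)" for R
  proof -
    have "dfn (\<lambda>e. a < e 0 0 \<and> e 0 0 < b \<and> R (e 0 0))"
      by (intro dfn_rules R(1)) auto
    from dfn_infinite_imp_interval[OF this R(2)]
    obtain c d where "c < d" "\<And>x. c < x \<Longrightarrow> x < d \<Longrightarrow> a < x \<and> x < b \<and> R x" by blast
    moreover from this obtain x where "c < x" "x < d" using dense by blast
    ultimately show False using ab(2)[of x] R(3) unfolding bdry_def by blast
  qed
  have "{a<..<b} = {x. a < x \<and> x < b \<and> Q x} \<union> {x. a < x \<and> x < b \<and> \<not> Q x}" by auto
  then have "infinite {x. a < x \<and> x < b \<and> Q x} \<or> infinite {x. a < x \<and> x < b \<and> \<not> Q x}"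
    using infinite_Ioo[OF ab(1)] by (metis finite_UnI)
  then show False using no_interval[of Q] no_interval[of "\<lambda>x. \<not> Q x"] assms dfn_not by blast
qed

text \<open>Definable connectedness: the supremum of all \<open>z\<close> such that \<open>Q\<close>
  holds throughout \<open>[x, z]\<close> is a boundary point. In \<open>?R\<close> the relation
  \<open>\<le>\<close> appears as a negated \<open><\<close> to fit the closure rules.\<close>

lemma bdry_nonempty_aux:
  assumes "dfn (\<lambda>e. Q (e 0 0))" "Q x" "\<not> Q y" "x < y"
  shows "bdry {x. Q x} \<noteq> {}"
proof -
  let ?R = "\<lambda>z. \<not> z < x \<and> (\<forall>w. \<not> w < x \<and> \<not> z < w \<longrightarrow> Q w)"
  have "dfn (\<lambda>e. ?R (e 0 0))"
    by (intro dfn_rules dfn_subst1[OF assms(1)]) auto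
  moreover have "?R x" using assms(2) by auto
  moreover have "z \<le> y" if "?R z" for z
    using that assms(3,4) by (metis less_asym not_le)
  ultimately have "has_lub {z. ?R z}" by (rule dfn_has_lub)
  then obtain s where s: "\<And>b. (\<forall>z. ?R z \<longrightarrow> z \<le> b) \<longleftrightarrow> s \<le> b"
    unfolding has_lub_def by auto
  have "x \<le> s" "s \<le> y" using s[of s] s[of y] \<open>?R x\<close> \<open>\<And>z. ?R z \<Longrightarrow> z \<le> y\<close> by auto
  have below: "Q w" if "x \<le> w" "w < s" for w
    using s[of w] that by (auto simp: not_le not_less)
  have "s \<in> bdry {x. Q x}"
    unfolding bdry_def mem_Collect_eq
  proof (intro allI impI conjI; elim conjE)
    fix a b assume ab: "a < s" "s < b"
    show "\<exists>y>a. y < b \<and> Q y"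
    proof (cases "x = s")
      case True
      then show ?thesis using ab assms(2) by auto
    next
      case False
      then obtain w where "max a x < w" "w < s" using dense[of "max a x" s] ab \<open>x \<le> s\<close> by auto
      then show ?thesis using below[of w] ab by (intro exI[of _ w]) auto
    qed
    show "\<exists>y>a. y < b \<and> \<not> Q y"
    proof (rule ccontr)
      assume "\<not> (\<exists>y>a. y < b \<and> \<not> Q y)"
      then have Q: "Q w" if "a < w" "w < b" for w using that by blast
      then have "b \<le> y" using \<open>s \<le> y\<close> ab assms(3) by (meson leI less_le_trans)
      obtain z where "s < z" "z < b" using dense ab(2) by blast
      then have "?R z" using Q below ab \<open>x \<le> s\<close>
        by (metis leI le_less_trans less_le_trans not_less_iff_gr_or_eq)
      then show False using s[of s] \<open>s < z\<close> by auto
    qed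
  qed
  then show ?thesis by blast
qed

lemma bdry_nonempty:
  assumes "dfn (\<lambda>e. Q (e 0 0))" "Q x" "\<not> Q y"
  shows "bdry {x. Q x} \<noteq> {}"
proof (cases "x < y")
  case True
  then show ?thesis using bdry_nonempty_aux assms by blast
next
  case False
  then have "y < x" using assms by (metis linorder_neqE)
  then have "bdry {x. \<not> Q x} \<noteq> {}" using bdry_nonempty_aux[OF dfn_not[OF assms(1)]] assms by blast
  then show ?thesis using bdry_Compl[of "{x. Q x}"] by (simp add: Collect_neg_eq)
qed

text \<open>
  Boundary points replace a definable choice function: there are finitely many of them in each fibre, so
  either one of them occurs in infinitely many fibres, or together they fill an interval.
\<close>

lemma bdry_concentrated:
  assumes "dfn (\<lambda>e. J (e 0 0))" "dfn (\<lambda>e. X (e 0 0) (e 1 0))" "infinite {u. J u}" "0 < \<eta>"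
    and "\<And>u. J u \<Longrightarrow> (\<exists>v. X u v) \<and> (\<exists>v. \<not> X u v)"
  obtains c d u where "c \<le> d" "d < c + \<eta>" "J u" "c \<in> bdry {v. X u v}"
    "infinite {u. J u \<and> (\<exists>s. c \<le> s \<and> s \<le> d \<and> s \<in> bdry {v. X u v})}"
proof -
  let ?B = "{s. \<exists>u. J u \<and> s \<in> bdry {v. X u v}}"
  have fiber: "dfn (\<lambda>e. X u (e 0 0))" for u by (intro dfn_subst2[OF assms(2)]) auto
  have fin: "finite (bdry {v. X u v})" for u by (rule finite_bdry[OF fiber])
  have ne: "bdry {v. X u v} \<noteq> {}" if "J u" for u
    using bdry_nonempty[OF fiber] assms(5)[OF that] by blast
  show ?thesis
  proof (cases "finite ?B")
    case True
    have "{u. J u} = (\<Union>c\<in>?B. {u. J u \<and> c \<in> bdry {v. X u v}})" using ne by blast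
    then obtain c where "c \<in> ?B" "infinite {u. J u \<and> c \<in> bdry {v. X u v}}"
      using True assms(3) by (metis (no_types, lifting) finite_UN)
    moreover have "{u. J u \<and> (\<exists>s. c \<le> s \<and> s \<le> c \<and> s \<in> bdry {v. X u v})} = {u. J u \<and> c \<in> bdry {v. X u v}}"
      by auto
    ultimately show ?thesis using that[of c c] assms(4) by auto
  next
    case False
    moreover have "dfn (\<lambda>e. \<exists>u. J u \<and> e 0 0 \<in> bdry {v. X u v})"
      by (intro dfn_rules dfn_bdry[OF assms(2)] dfn_subst1[OF assms(1)]) auto
    ultimately obtain a b where ab: "a < b" "\<And>s. a < s \<Longrightarrow> s < b \<Longrightarrow> s \<in> ?B"
      using dfn_infinite_imp_interval[of "\<lambda>s. s \<in> ?B"] by auto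
    obtain c where c: "a < c" "c < b" using dense ab(1) by blast
    \<comment> \<open>The interval is shortened to respect \<open>\<eta>\<close>. Each fibre
      contributes finitely many boundary points, so covering it still takes infinitely many
      fibres.\<close>
    obtain d where d: "c < d" "d < min b (c + \<eta>)" using dense[of c "min b (c + \<eta>)"] c assms(4) by auto
    have "infinite {u. J u \<and> (\<exists>s. c \<le> s \<and> s \<le> d \<and> s \<in> bdry {v. X u v})}" (is "infinite ?U")
    proof
      assume "finite ?U"
      moreover have "{c<..<d} \<subseteq> (\<Union>u\<in>?U. bdry {v. X u v})"
      proof
        fix s assume s: "s \<in> {c<..<d}"
        then have "s \<in> ?B" using ab(2)[of s] c d by auto
        then obtain u where u: "J u" "s \<in> bdry {v. X u v}" by blast
        moreover have "c \<le> s" "s \<le> d" using s by auto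
        ultimately have "u \<in> ?U" by blast
        then show "s \<in> (\<Union>u\<in>?U. bdry {v. X u v})" using u(2) by blast
      qed
      ultimately show False using fin infinite_Ioo[OF d(1)] by (meson finite_UN_I finite_subset)
    qed
    \<comment> \<open>That \<open>c\<close> is itself a boundary point will show that the common
      interval length is positive.\<close>
    moreover have "c \<in> ?B" using ab(2) c by auto
    ultimately show ?thesis using that[of c d] d by auto
  qed
qed

text \<open>It is enough to find one interval \<open>(c, d)\<close> contained in infinitely many
  fibres: the set of such \<open>u\<close> is definable and infinite, so it contains an interval,
  which is the other side of the box.\<close>

lemma exists_open_box:
  assumes Z: "dfn (\<lambda>e. Z (e 0 0) (e 1 0))" and inf: "infinite {u. infinite {v. Z u v}}"
  obtains a b c d where "a < b" "c < d" "\<And>u v. a < u \<Longrightarrow> u < b \<Longrightarrow> c < v \<Longrightarrow> v < d \<Longrightarrow> Z u v"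
proof -
  note box = that
  have fiber: "dfn (\<lambda>e. Z u (e 0 0))" for u by (intro dfn_subst2[OF Z]) auto
  have finish: thesis if cd: "c < d" and cd_inf: "infinite {u. \<forall>v. c < v \<and> v < d \<longrightarrow> Z u v}" for c d
  proof -
    have "dfn (\<lambda>e. \<forall>v. c < v \<and> v < d \<longrightarrow> Z (e 0 0) v)"
      by (intro dfn_rules dfn_subst2[OF Z]) auto
    from dfn_infinite_imp_interval[OF this cd_inf]
    obtain a b where "a < b" "\<And>u. a < u \<Longrightarrow> u < b \<Longrightarrow> \<forall>v. c < v \<and> v < d \<longrightarrow> Z u v"
      by blast
    then show thesis using box \<open>c < d\<close> by blast
  qed
  define J where "J u \<longleftrightarrow> (\<exists>a b. a < b \<and> (\<forall>v. a < v \<and> v < b \<longrightarrow> Z u v))" for u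
  have J: "dfn (\<lambda>e. J (e 0 0))"
    unfolding J_def by (intro dfn_rules dfn_subst2[OF Z]) auto
  have "infinite {u. J u}"
    using inf dfn_infinite_iff[OF fiber] by (simp add: J_def)
  \<comment> \<open>First find a length \<open>\<delta>\<close> of intervals common to infinitely many fibres, then a common position.\<close>
  define A where "A \<delta> u a \<longleftrightarrow> (\<forall>v. a < v \<and> v < a + \<delta> \<longrightarrow> Z u v)" for \<delta> u a
  define D where "D u \<delta> \<longleftrightarrow> (\<exists>a. A \<delta> u a)" for u \<delta>
  have D: "dfn (\<lambda>e. D (e 0 0) (e 1 0))"
    unfolding D_def A_def by (intro dfn_rules dfn_subst2[OF Z]) auto
  have D_mono: "D u \<delta>" if "D u \<delta>'" "\<delta> \<le> \<delta>'" for u \<delta> \<delta>'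
    using that unfolding D_def A_def by (meson add_left_mono less_le_trans)
  have D_pos: "\<exists>\<delta>>0. D u \<delta>" if Ju: "J u" for u
  proof -
    obtain a b where "a < b" "\<forall>v. a < v \<and> v < b \<longrightarrow> Z u v" using Ju unfolding J_def by blast
    then show ?thesis unfolding D_def A_def by (intro exI[of _ "b - a"] conjI exI[of _ a]) auto
  qed
  have "\<exists>\<delta>>0. infinite {u. J u \<and> D u \<delta>}"
  \<comment> \<open>Fibres that contain intervals of every length give no boundary point in
    \<open>\<delta>\<close>. They are treated apart, with length 1.\<close>
  proof (cases "infinite {u. J u \<and> (\<forall>\<delta>. D u \<delta>)}")
    case True
    then have "infinite {u. J u \<and> D u 1}" by (rule infinite_super[rotated]) auto
    then show ?thesis using zero_less_one by blast
  next
    case False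
    let ?J = "\<lambda>u. J u \<and> (\<exists>\<delta>. \<not> D u \<delta>)"
    have "{u. J u} = {u. J u \<and> (\<forall>\<delta>. D u \<delta>)} \<union> {u. ?J u}" by blast
    then have "infinite {u. ?J u}" using False \<open>infinite {u. J u}\<close> by (metis finite_UnI)
    moreover have "dfn (\<lambda>e. ?J (e 0 0))"
      by (intro dfn_rules J dfn_subst2[OF D]) auto
    moreover have "(\<exists>\<delta>. D u \<delta>) \<and> (\<exists>\<delta>. \<not> D u \<delta>)" if "?J u" for u using D_pos that by blast
    ultimately obtain c d u where c: "J u" "c \<in> bdry {\<delta>. D u \<delta>}"
      "infinite {u. ?J u \<and> (\<exists>s. c \<le> s \<and> s \<le> d \<and> s \<in> bdry {\<delta>. D u \<delta>})}"
      using bdry_concentrated[where J = ?J and X = D, OF _ D _ zero_less_one] by blast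
    \<comment> \<open>\<open>D u\<close> is downward closed and holds at some positive length, so
      its boundary contains no number \<open>\<le> 0\<close>.\<close>
    have "0 < c"
    proof (rule ccontr)
      assume "\<not> 0 < c"
      obtain \<delta> where "\<delta> > 0" "D u \<delta>" using D_pos c(1) by blast
      then have "c - 1 < c" "c < \<delta>" using \<open>\<not> 0 < c\<close> by auto
      then obtain y where "y < \<delta>" "\<not> D u y" using c(2) unfolding bdry_def by blast
      then show False using D_mono[OF \<open>D u \<delta>\<close>, of y] by auto
    qed
    \<comment> \<open>A boundary point \<open>s \<ge> c\<close> need not be attained as a length,
      but lengths arbitrarily close to it are; one exceeding \<open>c / 2\<close> suffices by
      monotonicity.\<close>
    have "D u (c / 2)" if s: "c \<le> s" "s \<in> bdry {\<delta>. D u \<delta>}" for u s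
    proof -
      have "c / 2 < s" "s < s + 1" using s \<open>0 < c\<close> by (auto simp: field_simps)
      then obtain y where "c / 2 < y" "D u y" using s(2) unfolding bdry_def by blast
      then show ?thesis using D_mono[of u y "c / 2"] by auto
    qed
    then have "infinite {u. J u \<and> D u (c / 2)}"
      by (intro infinite_super[OF _ c(3)]) auto
    then show ?thesis using \<open>0 < c\<close> half_gt_zero by blast
  qed
  then obtain \<delta> where \<delta>: "\<delta> > 0" "infinite {u. J u \<and> D u \<delta>}" by blast
  show thesis
  proof (cases "infinite {u. J u \<and> (\<forall>a. A \<delta> u a)}")
    case True
    then have "infinite {u. \<forall>v. 0 < v \<and> v < \<delta> \<longrightarrow> Z u v}"
      by (rule infinite_super[rotated]) (auto simp: A_def dest: spec[of _ 0])
    then show thesis using finish \<delta>(1) by blast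
  next
    case False
    let ?J = "\<lambda>u. J u \<and> D u \<delta> \<and> (\<exists>a. \<not> A \<delta> u a)"
    have "{u. J u \<and> D u \<delta>} \<subseteq> {u. J u \<and> (\<forall>a. A \<delta> u a)} \<union> {u. ?J u}" by blast
    then have "infinite {u. ?J u}" using False \<delta>(2) by (meson finite_UnI finite_subset)
    have A: "dfn (\<lambda>e. A \<delta> (e 0 0) (e 1 0))"
      unfolding A_def by (intro dfn_rules dfn_subst2[OF Z]) auto
    have "dfn (\<lambda>e. ?J (e 0 0))"
      by (intro dfn_rules J dfn_subst2[OF D] dfn_subst2[where X = "A \<delta>", OF A]) auto
    moreover have "(\<exists>a. A \<delta> u a) \<and> (\<exists>a. \<not> A \<delta> u a)" if "?J u" for u using that D_def by blast
    moreover have "0 < \<delta> / 4" using \<delta>(1) by simp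
    ultimately obtain c d where cd: "c \<le> d" "d < c + \<delta> / 4"
      "infinite {u. ?J u \<and> (\<exists>s. c \<le> s \<and> s \<le> d \<and> s \<in> bdry {a. A \<delta> u a})}"
      using bdry_concentrated[where J = ?J and X = "A \<delta>", OF _ A \<open>infinite {u. ?J u}\<close>] by blast
    \<comment> \<open>Boundary positions \<open>s\<close> spread over less than
      \<open>\<delta> / 4\<close>, and a good left end \<open>a\<close> lies within
      \<open>\<delta> / 4\<close> of \<open>s\<close>. Hence
      \<open>c - \<delta> / 4 < a < c + \<delta> / 2\<close>, and every interval
      \<open>(a, a + \<delta>)\<close> contains the window
      \<open>(c + \<delta> / 2, c + 3 * \<delta> / 4)\<close>.\<close>
    have "Z u v" if s: "c \<le> s" "s \<le> d" "s \<in> bdry {a. A \<delta> u a}" "c + \<delta> / 2 < v" "v < c + 3 * \<delta> / 4" for u s v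
    proof -
      have "s - \<delta> / 4 < s" "s < s + \<delta> / 4" using \<delta>(1) by auto
      then obtain a where "s - \<delta> / 4 < a" "a < s + \<delta> / 4" "A \<delta> u a"
        using s(3) unfolding bdry_def by blast
      moreover have "a < v" "v < a + \<delta>" using calculation s cd by linarith+
      ultimately show ?thesis unfolding A_def by blast
    qed
    then have "infinite {u. \<forall>v. c + \<delta> / 2 < v \<and> v < c + 3 * \<delta> / 4 \<longrightarrow> Z u v}"
      by (intro infinite_super[OF _ cd(3)]) blast
    then show thesis using finish[of "c + \<delta> / 2" "c + 3 * \<delta> / 4"] \<delta>(1) by auto
  qed
qed

end

section \<open>Heyting algebras\<close>

notation heyting_imp (infixr \<open>\<rightharpoonup>\<index>\<close> 60)

context heyting_algebra
begin

declare le_antisym [rule del] weak_le_antisym [rule del]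

section \<open>Residuation\<close>

lemma greatest_imp:
  assumes "x \<in> carrier L" "y \<in> carrier L"
  shows "greatest L (x \<rightharpoonup> y) {z \<in> carrier L. x \<sqinter> z \<sqsubseteq> y}"
proof -
  obtain m where m: "greatest L m {z \<in> carrier L. x \<sqinter> z \<sqsubseteq> y}" using imp_exists assms by blast
  then have "m' = m" if "greatest L m' {z \<in> carrier L. x \<sqinter> z \<sqsubseteq> y}" for m'
    using that greatest_unique by blast
  then show ?thesis unfolding heyting_imp_def using theI[of "\<lambda>m. greatest L m _", OF m] by blast
qed

lemma imp_closed [simp]: "x \<in> carrier L \<Longrightarrow> y \<in> carrier L \<Longrightarrow> x \<rightharpoonup> y \<in> carrier L"
  using greatest_imp by blast

lemma le_meet_iff [simp]:
  "x \<in> carrier L \<Longrightarrow> y \<in> carrier L \<Longrightarrow> z \<in> carrier L \<Longrightarrow> z \<sqsubseteq> x \<sqinter> y \<longleftrightarrow> z \<sqsubseteq> x \<and> z \<sqsubseteq> y"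
  by (meson le_trans meet_closed meet_le meet_left meet_right)

lemma join_le_iff [simp]:
  "x \<in> carrier L \<Longrightarrow> y \<in> carrier L \<Longrightarrow> z \<in> carrier L \<Longrightarrow> x \<squnion> y \<sqsubseteq> z \<longleftrightarrow> x \<sqsubseteq> z \<and> y \<sqsubseteq> z"
  by (meson le_trans join_closed join_le join_left join_right)

lemma meet_le_left: "x \<in> carrier L \<Longrightarrow> y \<in> carrier L \<Longrightarrow> z \<in> carrier L \<Longrightarrow> x \<sqsubseteq> z \<Longrightarrow> x \<sqinter> y \<sqsubseteq> z"
  and meet_le_right: "x \<in> carrier L \<Longrightarrow> y \<in> carrier L \<Longrightarrow> z \<in> carrier L \<Longrightarrow> y \<sqsubseteq> z \<Longrightarrow> x \<sqinter> y \<sqsubseteq> z"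
  and le_join_left: "x \<in> carrier L \<Longrightarrow> y \<in> carrier L \<Longrightarrow> z \<in> carrier L \<Longrightarrow> z \<sqsubseteq> x \<Longrightarrow> z \<sqsubseteq> x \<squnion> y"
  and le_join_right: "x \<in> carrier L \<Longrightarrow> y \<in> carrier L \<Longrightarrow> z \<in> carrier L \<Longrightarrow> z \<sqsubseteq> y \<Longrightarrow> z \<sqsubseteq> x \<squnion> y"
  by (blast intro: le_trans meet_left meet_right join_left join_right meet_closed join_closed)+

lemmas order_simps = meet_le_left meet_le_right le_join_left le_join_right

lemma le_imp_iff:
  assumes "x \<in> carrier L" "y \<in> carrier L" "z \<in> carrier L"
  shows "z \<sqsubseteq> x \<rightharpoonup> y \<longleftrightarrow> z \<sqinter> x \<sqsubseteq> y"
proof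
  have g: "x \<sqinter> (x \<rightharpoonup> y) \<sqsubseteq> y" using greatest_imp[OF assms(1,2)] greatest_mem by fastforce
  assume "z \<sqsubseteq> x \<rightharpoonup> y"
  then have "z \<sqinter> x \<sqsubseteq> x \<sqinter> (x \<rightharpoonup> y)"
    using assms by (simp add: meet_right) (meson imp_closed le_trans meet_closed meet_left)
  then show "z \<sqinter> x \<sqsubseteq> y" using g assms by (meson imp_closed le_trans meet_closed)
next
  assume "z \<sqinter> x \<sqsubseteq> y"
  then show "z \<sqsubseteq> x \<rightharpoonup> y"
    using greatest_le[OF greatest_imp[OF assms(1,2)]] assms by (simp add: meet_comm)
qed

lemma le_imp_self: "x \<in> carrier L \<Longrightarrow> y \<in> carrier L \<Longrightarrow> y \<sqsubseteq> x \<rightharpoonup> y"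
  by (simp add: le_imp_iff meet_left)

lemma imp_meet_le: "x \<in> carrier L \<Longrightarrow> y \<in> carrier L \<Longrightarrow> (x \<rightharpoonup> y) \<sqinter> x \<sqsubseteq> y"
  using le_imp_iff[of x y "x \<rightharpoonup> y"] by simp

lemma le_imp_imp: "x \<in> carrier L \<Longrightarrow> y \<in> carrier L \<Longrightarrow> y \<sqsubseteq> (y \<rightharpoonup> x) \<rightharpoonup> x"
  by (simp add: le_imp_iff) (metis imp_meet_le meet_comm)

lemma meet_mono:
  assumes "x \<in> carrier L" "y \<in> carrier L" "x' \<in> carrier L" "y' \<in> carrier L" "x \<sqsubseteq> x'" "y \<sqsubseteq> y'"
  shows "x \<sqinter> y \<sqsubseteq> x' \<sqinter> y'"
  using assms le_trans[OF meet_left, of x y x'] le_trans[OF meet_right, of x y y'] by simp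

lemma imp_antimono:
  assumes "x \<in> carrier L" "y \<in> carrier L" "z \<in> carrier L" "y \<sqsubseteq> z"
  shows "z \<rightharpoonup> x \<sqsubseteq> y \<rightharpoonup> x"
proof -
  have "(z \<rightharpoonup> x) \<sqinter> y \<sqsubseteq> (z \<rightharpoonup> x) \<sqinter> z"
    using assms by (intro meet_mono) auto
  then have "(z \<rightharpoonup> x) \<sqinter> y \<sqsubseteq> x"
    using assms imp_meet_le[of z x] by (meson imp_closed le_trans meet_closed)
  then show ?thesis using assms by (simp add: le_imp_iff)
qed

text \<open>These are the fixed points of
  \<open>m \<mapsto> (m \<rightharpoonup> x) \<rightharpoonup> x\<close>. As a Boolean algebra it
  has bottom \<open>x\<close>, complement \<open>m \<rightharpoonup> x\<close>, the meet of
  \<open>L\<close>, and the join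
  \<open>((b \<squnion> c) \<rightharpoonup> x) \<rightharpoonup> x\<close>.\<close>

definition regulars :: "'a \<Rightarrow> 'a set" where
  "regulars x = {y \<rightharpoonup> x | y. y \<in> carrier L}"

lemma regulars_closed: "x \<in> carrier L \<Longrightarrow> regulars x \<subseteq> carrier L"
  by (auto simp: regulars_def)

lemma imp_in_regulars: "b \<in> carrier L \<Longrightarrow> b \<rightharpoonup> x \<in> regulars x"
  by (auto simp: regulars_def)

lemma regulars_imp_imp:
  assumes "x \<in> carrier L" "m \<in> regulars x"
  shows "(m \<rightharpoonup> x) \<rightharpoonup> x = m"
proof -
  obtain y where y: "y \<in> carrier L" "m = y \<rightharpoonup> x" using assms(2) by (auto simp: regulars_def)
  have "(m \<rightharpoonup> x) \<rightharpoonup> x \<sqsubseteq> m"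
    unfolding y(2) using y(1) assms(1) le_imp_imp[of x y] by (intro imp_antimono) auto
  then show ?thesis using le_imp_imp[of x m] y assms(1) by (intro le_antisym) auto
qed

lemma le_regular: "x \<in> carrier L \<Longrightarrow> m \<in> regulars x \<Longrightarrow> x \<sqsubseteq> m"
  by (auto simp: regulars_def le_imp_self)

lemma le_regularI:
  assumes "x \<in> carrier L" "m \<in> carrier L" "m' \<in> regulars x" "m \<sqinter> (m' \<rightharpoonup> x) \<sqsubseteq> x"
  shows "m \<sqsubseteq> m'"
proof -
  have "m' \<in> carrier L" using assms(1,3) regulars_closed by blast
  then have "m \<sqsubseteq> (m' \<rightharpoonup> x) \<rightharpoonup> x" using assms by (simp add: le_imp_iff)
  then show ?thesis using regulars_imp_imp assms by simp
qed

lemma regulars_meet: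
  assumes "x \<in> carrier L" "m \<in> regulars x" "m' \<in> regulars x"
  shows "m \<sqinter> m' \<in> regulars x"
proof -
  have c: "m \<in> carrier L" "m' \<in> carrier L" using assms regulars_closed by blast+
  let ?d = "((m \<sqinter> m') \<rightharpoonup> x) \<rightharpoonup> x"
  have "?d \<sqsubseteq> (m \<rightharpoonup> x) \<rightharpoonup> x" "?d \<sqsubseteq> (m' \<rightharpoonup> x) \<rightharpoonup> x"
    using assms(1) c by (intro imp_antimono; simp add: meet_left meet_right)+
  then have "?d \<sqsubseteq> m \<sqinter> m'" using assms c by (simp add: regulars_imp_imp)
  then have "?d = m \<sqinter> m'" using assms(1) c le_imp_imp by (intro le_antisym) auto
  then show ?thesis using assms(1) c by (metis imp_closed imp_in_regulars meet_closed)
qed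

text \<open>Excluded middle for \<open>b\<close> and \<open>b \<rightharpoonup> x\<close> is
  available when the target \<open>m'\<close> is regular, although \<open>b\<close> need not be. The
  part \<open>?t\<close> of \<open>m\<close> outside \<open>m'\<close> meets \<open>b\<close> inside
  \<open>x\<close>, so it lies below \<open>b \<rightharpoonup> x\<close>, hence below
  \<open>m'\<close> as well as its complement.\<close>

lemma regular_le_by_cases:
  assumes "x \<in> carrier L" "b \<in> carrier L" "m \<in> carrier L" "m' \<in> regulars x"
    and "m \<sqinter> b \<sqsubseteq> m'" "m \<sqinter> (b \<rightharpoonup> x) \<sqsubseteq> m'"
  shows "m \<sqsubseteq> m'"
proof (rule le_regularI[OF assms(1,3,4)])
  have m': "m' \<in> carrier L" using assms(1,4) regulars_closed by blast
  note c = assms(1-3) m'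
  let ?t = "m \<sqinter> (m' \<rightharpoonup> x)"
  have t: "?t \<sqsubseteq> m" "?t \<sqsubseteq> m' \<rightharpoonup> x" using c by (simp_all add: meet_left meet_right)
  have bot: "u \<sqsubseteq> x" if "u \<in> carrier L" "u \<sqsubseteq> m'" "u \<sqsubseteq> m' \<rightharpoonup> x" for u
  proof -
    have "u \<sqsubseteq> (m' \<rightharpoonup> x) \<sqinter> m'" using that c by simp
    then show ?thesis using imp_meet_le[of m' x] that c by (meson imp_closed le_trans meet_closed)
  qed
  have "?t \<sqinter> b \<sqsubseteq> m \<sqinter> b" using t c by (intro meet_mono) auto
  then have "?t \<sqinter> b \<sqsubseteq> m'" using assms(5) c by (meson imp_closed le_trans meet_closed)
  moreover have "?t \<sqinter> b \<sqsubseteq> m' \<rightharpoonup> x" using t c by (meson imp_closed le_trans meet_closed meet_left)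
  ultimately have "?t \<sqinter> b \<sqsubseteq> x" using bot c by simp
  then have "?t \<sqsubseteq> b \<rightharpoonup> x" using c by (simp add: le_imp_iff)
  then have "?t \<sqsubseteq> m \<sqinter> (b \<rightharpoonup> x)" using t c by simp
  then have "?t \<sqsubseteq> m'" using assms(6) c by (meson imp_closed le_trans meet_closed)
  then show "?t \<sqsubseteq> x" using bot t c by simp
qed

text \<open>On \<open>b \<squnion> c\<close> distributivity splits the cases; on its complement
  \<open>m\<close> shrinks to the bottom \<open>x\<close>, because \<open>m\<close> lies below the
  regular join.\<close>

lemma regular_le_by_join_cases:
  assumes "x \<in> carrier L" "b \<in> carrier L" "c \<in> carrier L" "m \<in> carrier L" "m' \<in> regulars x"
    and "m \<sqsubseteq> ((b \<squnion> c) \<rightharpoonup> x) \<rightharpoonup> x" "m \<sqinter> b \<sqsubseteq> m'" "m \<sqinter> c \<sqsubseteq> m'"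
  shows "m \<sqsubseteq> m'"
proof -
  have m': "m' \<in> carrier L" using assms(1,5) regulars_closed by blast
  let ?d = "(b \<squnion> c) \<rightharpoonup> x"
  have "m \<sqinter> (b \<squnion> c) \<sqsubseteq> m'" using assms m' by (simp add: meet_join_distrib)
  moreover have "m \<sqinter> ?d \<sqsubseteq> (?d \<rightharpoonup> x) \<sqinter> ?d" using assms by (intro meet_mono) auto
  then have "m \<sqinter> ?d \<sqsubseteq> x" using imp_meet_le[of ?d x] assms by (meson imp_closed join_closed le_trans meet_closed)
  then have "m \<sqinter> ?d \<sqsubseteq> m'"
    using le_regular[of x m'] assms m' by (meson imp_closed join_closed le_trans meet_closed)
  ultimately show ?thesis
    using regular_le_by_cases[of x "b \<squnion> c" m m'] assms(1-5) by simp
qed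

text \<open>A regular element is determined by its parts below \<open>b\<close> and below the
  complement of \<open>b\<close>.\<close>

lemma finite_regularsI:
  assumes "x \<in> carrier L" "b \<in> regulars x"
    and "finite {m \<in> regulars x. m \<sqsubseteq> b}" "finite {m \<in> regulars x. m \<sqsubseteq> b \<rightharpoonup> x}"
  shows "finite (regulars x)"
proof (rule inj_on_finite)
  have c: "m \<in> carrier L" if "m \<in> regulars x" for m using that assms(1) regulars_closed by blast
  let ?f = "\<lambda>m. (m \<sqinter> b, m \<sqinter> (b \<rightharpoonup> x))"
  show "inj_on ?f (regulars x)"
  proof (rule inj_onI)
    fix m m' assume m: "m \<in> regulars x" "m' \<in> regulars x" "?f m = ?f m'"
    then have "m \<sqinter> b \<sqsubseteq> m'" "m' \<sqinter> b \<sqsubseteq> m" "m \<sqinter> (b \<rightharpoonup> x) \<sqsubseteq> m'" "m' \<sqinter> (b \<rightharpoonup> x) \<sqsubseteq> m"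
      using c assms(1,2) by (metis imp_closed meet_left prod.inject)+
    moreover have "b \<in> carrier L" "m \<in> carrier L" "m' \<in> carrier L" using c m assms(2) by blast+
    ultimately show "m = m'"
      using m(1,2) assms(1) by (meson le_antisym regular_le_by_cases)
  qed
  show "?f ` regulars x \<subseteq> {m \<in> regulars x. m \<sqsubseteq> b} \<times> {m \<in> regulars x. m \<sqsubseteq> b \<rightharpoonup> x}"
    using assms(1,2) c by (auto intro!: regulars_meet imp_in_regulars meet_right)
qed (use assms in simp)

lemma finite_regulars_below_join:
  assumes "x \<in> carrier L" "b \<in> regulars x" "c \<in> regulars x"
    and "finite {m \<in> regulars x. m \<sqsubseteq> b}" "finite {m \<in> regulars x. m \<sqsubseteq> c}"
  shows "finite {m \<in> regulars x. m \<sqsubseteq> ((b \<squnion> c) \<rightharpoonup> x) \<rightharpoonup> x}"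
proof (rule inj_on_finite)
  let ?A = "{m \<in> regulars x. m \<sqsubseteq> ((b \<squnion> c) \<rightharpoonup> x) \<rightharpoonup> x}"
  have cl: "m \<in> carrier L" if "m \<in> regulars x" for m using that assms(1) regulars_closed by blast
  let ?f = "\<lambda>m. (m \<sqinter> b, m \<sqinter> c)"
  show "inj_on ?f ?A"
  proof (rule inj_onI)
    fix m m' assume m: "m \<in> ?A" "m' \<in> ?A" "?f m = ?f m'"
    then have "m \<sqinter> b \<sqsubseteq> m'" "m' \<sqinter> b \<sqsubseteq> m" "m \<sqinter> c \<sqsubseteq> m'" "m' \<sqinter> c \<sqsubseteq> m"
      using cl assms(1-3) by (metis (no_types, lifting) mem_Collect_eq meet_left prod.inject)+
    moreover have "b \<in> carrier L" "c \<in> carrier L" "m \<in> carrier L" "m' \<in> carrier L"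
      using cl m(1,2) assms(2,3) by blast+
    moreover have "m \<in> regulars x" "m' \<in> regulars x" "m \<sqsubseteq> ((b \<squnion> c) \<rightharpoonup> x) \<rightharpoonup> x" "m' \<sqsubseteq> ((b \<squnion> c) \<rightharpoonup> x) \<rightharpoonup> x"
      using m(1,2) by blast+
    ultimately show "m = m'"
      using assms(1) by (meson le_antisym regular_le_by_join_cases)
  qed
  show "?f ` ?A \<subseteq> {m \<in> regulars x. m \<sqsubseteq> b} \<times> {m \<in> regulars x. m \<sqsubseteq> c}"
    using assms(1-3) cl by (auto intro!: regulars_meet meet_right)
qed (use assms in simp)

section \<open>Finite intervals and nearness\<close>

definition interval :: "'a \<Rightarrow> 'a \<Rightarrow> 'a set" where
  "interval a b = {x \<in> carrier L. a \<sqsubseteq> x \<and> x \<sqsubseteq> b}"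

lemma meet_join_distrib_right:
  "\<lbrakk>x \<in> carrier L; y \<in> carrier L; z \<in> carrier L\<rbrakk> \<Longrightarrow> (y \<squnion> z) \<sqinter> x = (y \<sqinter> x) \<squnion> (z \<sqinter> x)"
  using meet_join_distrib[of x y z] by (simp add: meet_comm)

lemma absorb:
  assumes "x \<in> carrier L" "y \<in> carrier L" "x \<sqsubseteq> y"
  shows "x \<sqinter> y = x" "y \<sqinter> x = x" "x \<squnion> y = y" "y \<squnion> x = y"
proof -
  show 1: "x \<sqinter> y = x" "x \<squnion> y = y" using assms le_iff_join le_iff_meet by metis+
  show "y \<sqinter> x = x" "y \<squnion> x = y" using 1 by (simp_all add: meet_comm join_comm)
qed

text \<open>This makes \<open>x \<mapsto> (x \<sqinter> b, x \<squnion> b)\<close> injective, the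
  counting device for glued intervals and for nearness classes.\<close>

lemma distributive_cancel:
  assumes "x \<in> carrier L" "y \<in> carrier L" "b \<in> carrier L" "x \<sqinter> b = y \<sqinter> b" "x \<squnion> b = y \<squnion> b"
  shows "x = y"
proof -
  have *: "u \<sqsubseteq> v" if "u \<in> carrier L" "v \<in> carrier L" "u \<sqinter> b = v \<sqinter> b" "u \<squnion> b = v \<squnion> b" for u v
  proof -
    have "u = u \<sqinter> (v \<squnion> b)" using that assms(3) by (metis absorb(1) join_closed join_left)
    also have "\<dots> = (u \<sqinter> v) \<squnion> (v \<sqinter> b)" using that assms(3) by (simp add: meet_join_distrib)
    finally have "u = (u \<sqinter> v) \<squnion> (v \<sqinter> b)" .
    moreover have "(u \<sqinter> v) \<squnion> (v \<sqinter> b) \<sqsubseteq> v" using that assms(3) by (simp add: meet_left meet_right)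
    ultimately show ?thesis by simp
  qed
  then show ?thesis using assms by (metis le_antisym)
qed

lemma interval_mono:
  assumes "a \<in> carrier L" "a' \<in> carrier L" "b \<in> carrier L" "b' \<in> carrier L" "a \<sqsubseteq> a'" "b' \<sqsubseteq> b"
  shows "interval a' b' \<subseteq> interval a b"
  using assms unfolding interval_def by (auto intro: le_trans)

lemma finite_interval_trans:
  assumes "a \<in> carrier L" "b \<in> carrier L" "c \<in> carrier L" "a \<sqsubseteq> b" "b \<sqsubseteq> c"
    and "finite (interval a b)" "finite (interval b c)"
  shows "finite (interval a c)"
proof (rule inj_on_finite)
  let ?f = "\<lambda>x. (x \<sqinter> b, x \<squnion> b)"
  show "inj_on ?f (interval a c)"
    using assms(2) by (intro inj_onI) (auto simp: interval_def intro: distributive_cancel)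
  show "?f ` interval a c \<subseteq> interval a b \<times> interval b c"
    using assms(1-5) by (auto simp: interval_def meet_right join_right)
qed (use assms in simp)

text \<open>The translated interval embeds into \<open>[a, b]\<close> by
  \<open>x \<mapsto> x \<sqinter> b\<close>, which distributivity lets one undo by joining
  \<open>c\<close>. With the dual statement this is what makes nearness a congruence.\<close>

lemma finite_interval_join:
  assumes "a \<in> carrier L" "b \<in> carrier L" "c \<in> carrier L" "a \<sqsubseteq> b" "finite (interval a b)"
  shows "finite (interval (a \<squnion> c) (b \<squnion> c))"
proof (rule inj_on_finite)
  have inv: "x = (x \<sqinter> b) \<squnion> c" if "x \<in> interval (a \<squnion> c) (b \<squnion> c)" for x
  proof -
    have "x \<in> carrier L" "a \<squnion> c \<sqsubseteq> x" "x \<sqsubseteq> b \<squnion> c" using that by (simp_all add: interval_def)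
    then have x: "x \<in> carrier L" "c \<sqsubseteq> x" "x \<sqsubseteq> b \<squnion> c" using assms by simp_all
    then have "x = x \<sqinter> (b \<squnion> c)" using assms by (simp add: absorb)
    also have "\<dots> = (x \<sqinter> b) \<squnion> (x \<sqinter> c)" using x assms by (intro meet_join_distrib) auto
    also have "x \<sqinter> c = c" using x assms by (intro absorb)
    finally show ?thesis .
  qed
  show "inj_on (\<lambda>x. x \<sqinter> b) (interval (a \<squnion> c) (b \<squnion> c))"
    by (rule inj_on_inverseI[where g = "\<lambda>y. y \<squnion> c", OF inv[symmetric]])
  show "(\<lambda>x. x \<sqinter> b) ` interval (a \<squnion> c) (b \<squnion> c) \<subseteq> interval a b"
    using assms(1-4) by (auto simp: interval_def meet_right)
qed (fact assms)

lemma finite_interval_meet: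
  assumes "a \<in> carrier L" "b \<in> carrier L" "c \<in> carrier L" "a \<sqsubseteq> b" "finite (interval a b)"
  shows "finite (interval (a \<sqinter> c) (b \<sqinter> c))"
proof (rule inj_on_finite)
  have inv: "x = (x \<squnion> a) \<sqinter> c" if "x \<in> interval (a \<sqinter> c) (b \<sqinter> c)" for x
  proof -
    have "x \<in> carrier L" "a \<sqinter> c \<sqsubseteq> x" "x \<sqsubseteq> b \<sqinter> c" using that by (simp_all add: interval_def)
    then have x: "x \<in> carrier L" "a \<sqinter> c \<sqsubseteq> x" "x \<sqsubseteq> c" using assms by simp_all
    then have "x \<sqinter> c = x" "(a \<sqinter> c) \<squnion> x = x" using assms by (simp_all add: absorb)
    then show ?thesis using x assms by (simp add: meet_join_distrib_right join_comm)
  qed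
  show "inj_on (\<lambda>x. x \<squnion> a) (interval (a \<sqinter> c) (b \<sqinter> c))"
    by (rule inj_on_inverseI[where g = "\<lambda>y. y \<sqinter> c", OF inv[symmetric]])
  show "(\<lambda>x. x \<squnion> a) ` interval (a \<sqinter> c) (b \<sqinter> c) \<subseteq> interval a b"
    using assms(1-4) by (auto simp: interval_def join_right)
qed (fact assms)

definition near :: "'a \<Rightarrow> 'a \<Rightarrow> bool" where
  "near x y \<longleftrightarrow> finite (interval (x \<sqinter> y) (x \<squnion> y))"

lemma nearI:
  assumes "x \<in> interval a b" "y \<in> interval a b" "a \<in> carrier L" "b \<in> carrier L" "finite (interval a b)"
  shows "near x y"
  unfolding near_def
  by (rule finite_subset[OF interval_mono assms(5)]) (use assms in \<open>auto simp: interval_def\<close>)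

lemma nearE:
  assumes "near x y" "x \<in> carrier L" "y \<in> carrier L"
  obtains a b where "a \<in> carrier L" "b \<in> carrier L" "x \<in> interval a b" "y \<in> interval a b" 
    "a \<sqsubseteq> b" "finite (interval a b)"
proof
  show "x \<sqinter> y \<sqsubseteq> x \<squnion> y"
    using assms(2,3) by (meson join_closed join_left le_trans meet_closed meet_left)
qed (use assms in \<open>auto simp: near_def interval_def meet_left meet_right join_left join_right\<close>)

lemma near_refl: "x \<in> carrier L \<Longrightarrow> near x x"
  by (rule nearI[of x x x]) (auto simp: interval_def intro: finite_subset[of _ "{x}"] le_antisym)

lemma near_trans:
  assumes "near x y" "near y z" and c: "x \<in> carrier L" "y \<in> carrier L" "z \<in> carrier L"
  shows "near x z"
proof -
  obtain a b where ab: "a \<in> carrier L" "b \<in> carrier L" "x \<in> interval a b" "y \<in> interval a b"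
    "a \<sqsubseteq> b" "finite (interval a b)" using nearE[OF assms(1) c(1,2)] by blast
  obtain a' b' where ab': "a' \<in> carrier L" "b' \<in> carrier L" "y \<in> interval a' b'" "z \<in> interval a' b'"
    "a' \<sqsubseteq> b'" "finite (interval a' b')" using nearE[OF assms(2) c(2,3)] by blast
  have y: "a \<sqsubseteq> y" "y \<sqsubseteq> b" "a' \<sqsubseteq> y" "y \<sqsubseteq> b'" using ab ab' by (simp_all add: interval_def)
  have "finite (interval a' y)" "finite (interval y b')"
    using y ab' c by (auto intro!: finite_subset[OF interval_mono ab'(6)])
  \<comment> \<open>Since \<open>a \<sqsubseteq> y \<sqsubseteq> b\<close>, meeting
    \<open>[a', y]\<close> with \<open>a\<close> gives \<open>[a' \<sqinter> a, a]\<close> and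
    joining \<open>[y, b']\<close> with \<open>b\<close> gives \<open>[b, b' \<squnion> b]\<close>.
    These extend \<open>[a, b]\<close> at both ends.\<close>
  then have "finite (interval (a' \<sqinter> a) (y \<sqinter> a))" "finite (interval (y \<squnion> b) (b' \<squnion> b))"
    using y ab ab' c by (simp_all add: finite_interval_meet finite_interval_join)
  then have "finite (interval (a' \<sqinter> a) a)" "finite (interval b (b' \<squnion> b))"
    using y ab c by (simp_all add: absorb)
  moreover from this have "finite (interval (a' \<sqinter> a) b)"
    using ab ab' by (intro finite_interval_trans[of "a' \<sqinter> a" a b]) (simp_all add: order_simps)
  ultimately have "finite (interval (a' \<sqinter> a) (b' \<squnion> b))"
    using y ab ab' c le_trans[of a y b]
    by (intro finite_interval_trans[of "a' \<sqinter> a" b "b' \<squnion> b"]) (simp_all add: order_simps)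
  moreover have "x \<in> interval (a' \<sqinter> a) (b' \<squnion> b)" "z \<in> interval (a' \<sqinter> a) (b' \<squnion> b)"
    using ab ab' by (simp_all add: interval_def order_simps)
  ultimately show ?thesis using ab ab' by (intro nearI[of x "a' \<sqinter> a" "b' \<squnion> b"]) simp_all
qed

lemma near_join_right:
  assumes "near x y" and c: "x \<in> carrier L" "y \<in> carrier L" "z \<in> carrier L"
  shows "near (x \<squnion> z) (y \<squnion> z)"
proof -
  obtain a b where ab: "a \<in> carrier L" "b \<in> carrier L" "x \<in> interval a b" "y \<in> interval a b"
    "a \<sqsubseteq> b" "finite (interval a b)" using nearE[OF assms(1) c(1,2)] by blast
  show ?thesis
    using ab c finite_interval_join[OF ab(1,2) c(3) ab(5,6)]
    by (intro nearI[of _ "a \<squnion> z" "b \<squnion> z"])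
      (simp_all add: interval_def order_simps)
qed

lemma near_meet_right:
  assumes "near x y" and c: "x \<in> carrier L" "y \<in> carrier L" "z \<in> carrier L"
  shows "near (x \<sqinter> z) (y \<sqinter> z)"
proof -
  obtain a b where ab: "a \<in> carrier L" "b \<in> carrier L" "x \<in> interval a b" "y \<in> interval a b"
    "a \<sqsubseteq> b" "finite (interval a b)" using nearE[OF assms(1) c(1,2)] by blast
  show ?thesis
    using ab c finite_interval_meet[OF ab(1,2) c(3) ab(5,6)]
    by (intro nearI[of _ "a \<sqinter> z" "b \<sqinter> z"])
      (simp_all add: interval_def order_simps)
qed

lemma near_join:
  assumes "near x x'" "near y y'" "x \<in> carrier L" "x' \<in> carrier L" "y \<in> carrier L" "y' \<in> carrier L"
  shows "near (x \<squnion> y) (x' \<squnion> y')"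
proof -
  have "near (x \<squnion> y) (x' \<squnion> y)" "near (x' \<squnion> y) (x' \<squnion> y')"
    using near_join_right[of x x' y] near_join_right[of y y' x'] assms by (simp_all add: join_comm)
  from near_trans[OF this] show ?thesis using assms by simp
qed

lemma near_meet:
  assumes "near x x'" "near y y'" "x \<in> carrier L" "x' \<in> carrier L" "y \<in> carrier L" "y' \<in> carrier L"
  shows "near (x \<sqinter> y) (x' \<sqinter> y')"
proof -
  have "near (x \<sqinter> y) (x' \<sqinter> y)" "near (x' \<sqinter> y) (x' \<sqinter> y')"
    using near_meet_right[of x x' y] near_meet_right[of y y' x'] assms by (simp_all add: meet_comm)
  from near_trans[OF this] show ?thesis using assms by simp
qed

section \<open>Finitely generated sublattices\<close>

lemma
  assumes "x \<in> carrier L" "y \<in> carrier L" "z \<in> carrier L"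
  shows meet_assoc: "(x \<sqinter> y) \<sqinter> z = x \<sqinter> (y \<sqinter> z)" and meet_left_comm: "x \<sqinter> (y \<sqinter> z) = y \<sqinter> (x \<sqinter> z)"
    and join_assoc: "(x \<squnion> y) \<squnion> z = x \<squnion> (y \<squnion> z)" and join_left_comm: "x \<squnion> (y \<squnion> z) = y \<squnion> (x \<squnion> z)"
proof -
  have *: "(u \<sqinter> v) \<sqinter> w = u \<sqinter> (v \<sqinter> w)" "(u \<squnion> v) \<squnion> w = u \<squnion> (v \<squnion> w)"
    if "u \<in> carrier L" "v \<in> carrier L" "w \<in> carrier L" for u v w
    using weak_meet_assoc[OF that] weak_join_assoc[OF that] eq_is_equal by simp_all
  show "(x \<sqinter> y) \<sqinter> z = x \<sqinter> (y \<sqinter> z)" "(x \<squnion> y) \<squnion> z = x \<squnion> (y \<squnion> z)" using * assms by simp_all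
  show "x \<sqinter> (y \<sqinter> z) = y \<sqinter> (x \<sqinter> z)"
    using *(1)[of x y z] *(1)[of y x z] assms by (simp add: meet_comm[of L x y])
  show "x \<squnion> (y \<squnion> z) = y \<squnion> (x \<squnion> z)"
    using *(2)[of x y z] *(2)[of y x z] assms by (simp add: join_comm[of L x y])
qed

lemma meet_idem: "x \<in> carrier L \<Longrightarrow> x \<sqinter> x = x"
  by (simp add: absorb(1))

lemmas lattice_ac = meet_assoc meet_comm meet_left_comm join_assoc join_comm join_left_comm

definition sublattice :: "'a set \<Rightarrow> bool" where
  "sublattice K \<longleftrightarrow> K \<subseteq> carrier L \<and> \<bottom> \<in> K \<and> \<top> \<in> K \<and> (\<forall>x\<in>K. \<forall>y\<in>K. x \<sqinter> y \<in> K \<and> x \<squnion> y \<in> K)"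

text \<open>Lattice polynomials in \<open>s\<close> over \<open>K\<close> have the linear normal
  form \<open>(a \<sqinter> s) \<squnion> b\<close>, because \<open>s\<close> is idempotent. The
  meet of two of them has the coefficients of a product of linear polynomials, with the quadratic
  term absorbed into the linear one.\<close>

lemma finite_sublattice_insert:
  assumes "sublattice K" "finite K" "s \<in> carrier L"
  obtains K' where "sublattice K'" "finite K'" "insert s K \<subseteq> K'"
proof
  let ?K = "(\<lambda>(a, b). (a \<sqinter> s) \<squnion> b) ` (K \<times> K)"
  show "finite ?K" using assms(2) by simp
  have K: "\<And>a. a \<in> K \<Longrightarrow> a \<in> carrier L" "\<bottom> \<in> K" "\<top> \<in> K"
    "\<And>a b. a \<in> K \<Longrightarrow> b \<in> K \<Longrightarrow> a \<sqinter> b \<in> K" "\<And>a b. a \<in> K \<Longrightarrow> b \<in> K \<Longrightarrow> a \<squnion> b \<in> K"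
    using assms(1) unfolding sublattice_def by blast+
  have memI: "(a \<sqinter> s) \<squnion> b \<in> ?K" if "a \<in> K" "b \<in> K" for a b using that by force
  have "(\<bottom> \<sqinter> s) \<squnion> a = a" "(\<top> \<sqinter> s) \<squnion> \<bottom> = s" if "a \<in> K" for a
    using that K assms(3) by (simp_all add: absorb bottom_lower top_higher)
  then show sub: "insert s K \<subseteq> ?K" using memI K(2,3) by (metis insert_subset subsetI)
  have join: "((a \<sqinter> s) \<squnion> b) \<squnion> ((a' \<sqinter> s) \<squnion> b') = ((a \<squnion> a') \<sqinter> s) \<squnion> (b \<squnion> b')"
    if "a \<in> K" "b \<in> K" "a' \<in> K" "b' \<in> K" for a b a' b'
  proof -
    have c: "a \<in> carrier L" "b \<in> carrier L" "a' \<in> carrier L" "b' \<in> carrier L" using that K(1) by auto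
    show ?thesis
      using c assms(3) by (simp add: meet_join_distrib meet_join_distrib_right lattice_ac)
  qed
  have meet: "((a \<sqinter> s) \<squnion> b) \<sqinter> ((a' \<sqinter> s) \<squnion> b') =
      (((a \<sqinter> a') \<squnion> ((a \<sqinter> b') \<squnion> (a' \<sqinter> b))) \<sqinter> s) \<squnion> (b \<sqinter> b')"
    if "a \<in> K" "b \<in> K" "a' \<in> K" "b' \<in> K" for a b a' b'
  proof -
    have c: "a \<in> carrier L" "b \<in> carrier L" "a' \<in> carrier L" "b' \<in> carrier L" using that K(1) by auto
    have 1: "((a \<sqinter> s) \<squnion> b) \<sqinter> ((a' \<sqinter> s) \<squnion> b') = 
      (((a \<sqinter> s) \<sqinter> (a' \<sqinter> s)) \<squnion> (b \<sqinter> (a' \<sqinter> s))) \<squnion> (((a \<sqinter> s) \<sqinter> b') \<squnion> (b \<sqinter> b'))"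
      using c assms(3) by (simp add: meet_join_distrib meet_join_distrib_right)
    have 2: "(a \<sqinter> s) \<sqinter> (a' \<sqinter> s) = (a \<sqinter> a') \<sqinter> s" "b \<sqinter> (a' \<sqinter> s) = (a' \<sqinter> b) \<sqinter> s"
      "(a \<sqinter> s) \<sqinter> b' = (a \<sqinter> b') \<sqinter> s"
      using c assms(3) by (simp_all add: lattice_ac meet_idem)
    have 3: "((p \<squnion> q) \<squnion> (r \<squnion> t)) = (p \<squnion> (r \<squnion> q)) \<squnion> t"
      if "p \<in> carrier L" "q \<in> carrier L" "r \<in> carrier L" "t \<in> carrier L" for p q r t
      using that by (simp add: lattice_ac)
    show ?thesis unfolding 1 2 using c assms(3) by (simp add: 3 meet_join_distrib_right)
  qed
  have closed: "?K \<subseteq> carrier L" using K(1) assms(3) by auto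
  have ops: "u \<sqinter> v \<in> ?K \<and> u \<squnion> v \<in> ?K" if uv: "u \<in> ?K" "v \<in> ?K" for u v
  proof -
    obtain a b a' b' where *: "u = (a \<sqinter> s) \<squnion> b" "v = (a' \<sqinter> s) \<squnion> b'" "a \<in> K" "b \<in> K" "a' \<in> K" "b' \<in> K"
      using uv by auto
    show ?thesis unfolding *(1,2) join[OF *(3-6)] meet[OF *(3-6)] by (intro conjI; rule memI) (simp_all add: K(4,5) *(3-6))
  qed
  show "sublattice ?K"
    unfolding sublattice_def
  proof (intro conjI ballI)
    show "\<bottom> \<in> ?K" "\<top> \<in> ?K" using sub K(2,3) by (meson insert_subset subsetD)+
  qed (use ops in \<open>simp_all only:\<close>, rule closed)
qed

lemma finite_sublattice_exists:
  assumes "finite S" "S \<subseteq> carrier L"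
  shows "\<exists>K. sublattice K \<and> finite K \<and> S \<subseteq> K"
  using assms
proof (induction S rule: finite_induct)
  case empty
  have "sublattice {\<bottom>, \<top>}"
    unfolding sublattice_def by (auto simp: absorb bottom_lower top_higher)
  then show ?case by blast
next
  case (insert s S)
  then obtain K where "sublattice K" "finite K" "S \<subseteq> K" by auto
  then show ?case using finite_sublattice_insert[of K s] insert.prems by (metis insert_subset insertCI subset_trans)
qed

end

section \<open>Heyting algebras of dimension one\<close>

lemma infinite_coordinate:
  assumes "infinite X" "\<And>x. x \<in> X \<Longrightarrow> length x = n"
  shows "\<exists>j<n. infinite ((\<lambda>x. x ! j) ` X)"
proof (rule ccontr)
  assume "\<not> ?thesis"
  then have "finite (\<Union>j<n. (\<lambda>x. x ! j) ` X)" by blast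
  moreover have "X \<subseteq> {xs. set xs \<subseteq> (\<Union>j<n. (\<lambda>x. x ! j) ` X) \<and> length xs = n}"
    using assms(2) by (fastforce simp: in_set_conv_nth)
  ultimately show False using assms(1) finite_lists_length_eq finite_subset by blast
qed

locale definable_heyting_dim_one = ominimal F P n
  for F :: "'f \<Rightarrow> 'a list \<Rightarrow> 'a::linordered_field"
    and P :: "'r \<Rightarrow> 'a list \<Rightarrow> bool"
    and n :: nat +
  fixes H :: "'a list gorder" (structure)
  assumes definable_H: "definable_heyting_algebra F P n H"
    and dim_one: "o_dim n (carrier H) = 1"

sublocale definable_heyting_dim_one \<subseteq> heyting_algebra H
  using definable_H by (simp add: definable_heyting_algebra_def)

context definable_heyting_dim_one
begin

section \<open>Definability and coordinates in \<open>H\<close>\<close>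

lemma definable_carrier: "definable F P n (carrier H)"
  and definable_le: "definable F P (2 * n) {xs @ ys | xs ys. xs \<in> carrier H \<and> ys \<in> carrier H \<and> xs \<sqsubseteq> ys}"
  using definable_H by (simp_all add: definable_heyting_algebra_def)

lemma length_carrier: "x \<in> carrier H \<Longrightarrow> length x = n"
  using definable_carrier by (auto simp: definable_def)

lemma no_box_in_projection:
  assumes "i < n" "j < n" "i \<noteq> j" "a < b" "c < d"
  shows "\<exists>u v. a < u \<and> u < b \<and> c < v \<and> v < d \<and> \<not> (\<exists>x\<in>carrier H. x ! i = u \<and> x ! j = v)"
proof (rule ccontr)
  assume contr: "\<not> ?thesis"
  \<comment> \<open>\<open>o_dim\<close> projects along increasing lists of coordinates only, so
    \<open>i > j\<close> is reduced to this case by exchanging the axes.\<close>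
  have False if "k < l" "l < n" "a < b" "c < d"
    and box: "\<And>u v. a < u \<Longrightarrow> u < b \<Longrightarrow> c < v \<Longrightarrow> v < d \<Longrightarrow> \<exists>x\<in>carrier H. x ! k = u \<and> x ! l = v"
    for k l a b c d
  proof -
    have "open_box [a, c] [b, d] \<subseteq> coord_proj [k, l] ` carrier H"
    proof
      fix xs assume "xs \<in> open_box [a, c] [b, d]"
      then have "length xs = 2" "a < xs ! 0" "xs ! 0 < b" "c < xs ! 1" "xs ! 1 < d"
        by (auto simp: open_box_def numeral_2_eq_2 less_Suc_eq all_conj_distrib)
      moreover from this obtain x where "x \<in> carrier H" "x ! k = xs ! 0" "x ! l = xs ! 1"
        using box by blast
      ultimately have "xs = coord_proj [k, l] x"
        by (auto simp: coord_proj_def less_Suc_eq numeral_2_eq_2 intro!: nth_equalityI)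
      then show "xs \<in> coord_proj [k, l] ` carrier H" using \<open>x \<in> carrier H\<close> by blast
    qed
    then have "has_interior 2 (coord_proj [k, l] ` carrier H)"
      unfolding has_interior_def using that(3,4)
      by (intro exI[of _ "[a, c]"] exI[of _ "[b, d]"]) (auto simp: less_Suc_eq numeral_2_eq_2)
    then have "ereal (real 2) \<le> o_dim n (carrier H)"
      unfolding o_dim_def using that(1,2) by (intro SUP_upper) (auto intro!: exI[of _ "[k, l]"])
    then show False using dim_one by simp
  qed
  note no_box = this
  show False
  proof (cases "i < j")
    case True
    then show ?thesis using no_box[of i j a b c d] contr assms by blast
  next
    case False
    then have "j < i" using assms(3) by simp
    then show ?thesis using no_box[of j i c d a b] contr assms by blast
  qed
qed

text \<open>Definability is assumed only for the order between elements of the carrier, so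
  membership is built into the relation.\<close>

definition leq :: "'a list \<Rightarrow> 'a list \<Rightarrow> bool" where
  "leq x y \<longleftrightarrow> x \<in> carrier H \<and> y \<in> carrier H \<and> x \<sqsubseteq> y"

lemma dfn_carrier: "vec_term t \<Longrightarrow> dfn (\<lambda>e. t e \<in> carrier H)"
  by (rule dfn_definable[OF definable_carrier])

lemma dfn_leq: "vec_term s \<Longrightarrow> vec_term t \<Longrightarrow> dfn (\<lambda>e. leq (s e) (t e))"
  unfolding leq_def by (rule dfn_definable_rel[OF definable_le length_carrier])

lemma dfn_ex_carrier:
  assumes "dfn (\<lambda>e. Q (block (e 0)) (\<lambda>i. e (Suc i)))"
  shows "dfn (\<lambda>e. \<exists>x\<in>carrier H. Q x e)"
proof -
  have "dfn (\<lambda>e. \<exists>x. length x = n \<and> x \<in> carrier H \<and> Q x e)"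
    by (intro dfn_ex_vec dfn_conj dfn_carrier vec_term_block assms)
  moreover have "(\<exists>x. length x = n \<and> x \<in> carrier H \<and> Q x e) \<longleftrightarrow> (\<exists>x\<in>carrier H. Q x e)" for e
    using length_carrier by blast
  ultimately show ?thesis by simp
qed

lemma dfn_all_carrier:
  assumes "dfn (\<lambda>e. Q (block (e 0)) (\<lambda>i. e (Suc i)))"
  shows "dfn (\<lambda>e. \<forall>x\<in>carrier H. Q x e)"
  using dfn_not[OF dfn_ex_carrier[OF dfn_not[OF assms]]] by simp

lemmas carrier_rules = dfn_rules dfn_carrier dfn_leq dfn_ex_carrier dfn_all_carrier
  vec_term_block vec_term_const

text \<open>Eliminates the quantifier "infinitely many": a definable set of tuples is infinite iff
  some coordinate fills an interval on it. Finiteness conditions on definable families thereby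
  remain definable.\<close>

lemma dfn_infinite:
  assumes "dfn (\<lambda>e. Q (block (e 0)) (\<lambda>i. e (Suc i)))"
  shows "dfn (\<lambda>e. infinite {x \<in> carrier H. Q x e})"
proof -
  \<comment> \<open>O-minimality speaks about one variable, so the remaining blocks are turned into
    constants.\<close>
  have fix_env: "dfn (\<lambda>e'. Q (block (e' 0)) e)" for e
  proof -
    have "dfn (\<lambda>e'. (\<lambda>e. Q (block (e 0)) (\<lambda>i. e (Suc i))) (\<lambda>i. if i = 0 then e' 0 else e (i - 1)))"
      by (rule dfn_subst[OF _ assms]) (simp add: if_distrib[of "\<lambda>f. f _"] coords_if)
    then show ?thesis by simp
  qed
  have "infinite {x \<in> carrier H. Q x e} \<longleftrightarrow> (\<exists>j\<in>{..<n}. \<exists>a b. a < b \<and>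
      (\<forall>v. a < v \<and> v < b \<longrightarrow> (\<exists>x\<in>carrier H. x ! j = v \<and> Q x e)))" for e
  proof -
    have coord: "dfn (\<lambda>e'. \<exists>x\<in>carrier H. x ! j = e' 0 0 \<and> Q x e)" if "j < n" for j
      using that by (intro carrier_rules dfn_term_nth)
       (auto intro: dfn_subst[where \<sigma> = "\<lambda>e. e", OF _ fix_env])
    have *: "infinite {v. \<exists>x\<in>carrier H. x ! j = v \<and> Q x e} \<longleftrightarrow> (\<exists>a b. a < b \<and>
      (\<forall>v. a < v \<and> v < b \<longrightarrow> (\<exists>x\<in>carrier H. x ! j = v \<and> Q x e)))" if "j < n" for j
      by (rule dfn_infinite_iff[OF coord[OF that]])
    have "infinite {x \<in> carrier H. Q x e} \<longleftrightarrow> (\<exists>j<n. infinite {v. \<exists>x\<in>carrier H. x ! j = v \<and> Q x e})"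
    proof
      assume "infinite {x \<in> carrier H. Q x e}"
      from infinite_coordinate[OF this, of n]
      obtain j where "j < n" "infinite ((\<lambda>x. x ! j) ` {x \<in> carrier H. Q x e})"
        using length_carrier by blast
      moreover have "(\<lambda>x. x ! j) ` {x \<in> carrier H. Q x e} = {v. \<exists>x\<in>carrier H. x ! j = v \<and> Q x e}" by auto
      ultimately show "\<exists>j<n. infinite {v. \<exists>x\<in>carrier H. x ! j = v \<and> Q x e}" by auto
    next
      assume "\<exists>j<n. infinite {v. \<exists>x\<in>carrier H. x ! j = v \<and> Q x e}"
      then obtain j where "infinite {v. \<exists>x\<in>carrier H. x ! j = v \<and> Q x e}" by blast
      moreover have "{v. \<exists>x\<in>carrier H. x ! j = v \<and> Q x e} = (\<lambda>x. x ! j) ` {x \<in> carrier H. Q x e}" by auto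
      ultimately show "infinite {x \<in> carrier H. Q x e}" by auto
    qed
    then show ?thesis using * by auto
  qed
  moreover have "dfn (\<lambda>e. \<exists>j\<in>{..<n}. \<exists>a b. a < b \<and>
      (\<forall>v. a < v \<and> v < b \<longrightarrow> (\<exists>x\<in>carrier H. x ! j = v \<and> Q x e)))"
  proof (rule dfn_bex_finite)
    fix j assume "j \<in> {..<n}"
    then have "j < n" by simp
    \<comment> \<open>Below the quantifiers over \<open>a\<close>, \<open>b\<close>,
      \<open>v\<close> and \<open>x\<close> the outer environment starts at block 4.\<close>
    have "dfn (\<lambda>e'. (\<lambda>e. Q (block (e 0)) (\<lambda>i. e (Suc i))) (\<lambda>i. if i = 0 then e' 0 else e' (i + 3)))"
      by (rule dfn_subst[OF _ assms]) (simp add: if_distrib[of "\<lambda>f. f _"] coords_if)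
    then have "dfn (\<lambda>e. Q (block (e 0)) (\<lambda>i. e (Suc (Suc (Suc (Suc i))))))"
      by (simp add: numeral_3_eq_3)
    then show "dfn (\<lambda>e. \<exists>a b. a < b \<and> (\<forall>v. a < v \<and> v < b \<longrightarrow> (\<exists>x\<in>carrier H. x ! j = v \<and> Q x e)))"
      using \<open>j < n\<close> by (intro carrier_rules dfn_term_nth) auto
  qed simp
  ultimately show ?thesis by simp
qed

text \<open>Infinitely many infinite fibres would share, by pigeonhole, a second coordinate
  \<open>l\<close> that is infinite on infinitely many of them; \<open>l \<noteq> j\<close> since
  \<open>j\<close> is constant on a fibre. The resulting box contradicts dimension one.\<close>

lemma finite_bad_coordinates:
  assumes "j < n"
  shows "finite {v. infinite {x \<in> carrier H. x ! j = v}}" (is "finite ?V")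
proof (rule ccontr)
  assume inf: "infinite ?V"
  define Z where "Z l u v \<longleftrightarrow> (\<exists>x\<in>carrier H. x ! j = u \<and> x ! l = v)" for l u v
  have "?V = (\<Union>l\<in>{..<n}. {u \<in> ?V. infinite {v. Z l u v}})"
  proof (intro equalityI subsetI)
    fix u assume u: "u \<in> ?V"
    then obtain l where "l < n" "infinite ((\<lambda>x. x ! l) ` {x \<in> carrier H. x ! j = u})"
      using infinite_coordinate[of "{x \<in> carrier H. x ! j = u}" n] length_carrier by auto
    moreover have "(\<lambda>x. x ! l) ` {x \<in> carrier H. x ! j = u} = {v. Z l u v}" by (auto simp: Z_def)
    ultimately show "u \<in> (\<Union>l\<in>{..<n}. {u \<in> ?V. infinite {v. Z l u v}})" using u by auto
  qed auto
  then obtain l where l: "l < n" "infinite {u \<in> ?V. infinite {v. Z l u v}}"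
    using inf by (metis (no_types, lifting) finite_UN_I finite_lessThan lessThan_iff)
  have "infinite {u. infinite {v. Z l u v}}" by (rule infinite_super[OF _ l(2)]) auto
  have "l \<noteq> j"
  proof
    assume "l = j"
    then have "{v. Z l u v} \<subseteq> {u}" for u by (auto simp: Z_def)
    then have "finite {v. Z l u v}" for u by (meson finite.emptyI finite.insertI finite_subset)
    then show False using l(2) by simp
  qed
  have "dfn (\<lambda>e. Z l (e 0 0) (e 1 0))"
    unfolding Z_def using assms l(1) by (intro carrier_rules dfn_term_nth) auto
  from exists_open_box[OF this \<open>infinite {u. infinite {v. Z l u v}}\<close>]
  obtain a b c d where "a < b" "c < d" "\<And>u v. a < u \<Longrightarrow> u < b \<Longrightarrow> c < v \<Longrightarrow> v < d \<Longrightarrow> Z l u v" by blast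
  then show False using no_box_in_projection[of j l a b c d] assms l(1) \<open>l \<noteq> j\<close> unfolding Z_def by blast
qed

text \<open>Used contrapositively: a point-finite definable family indexed by \<open>H\<close> has
  only finitely many infinite members.\<close>

lemma infinite_family_overlaps:
  assumes \<rho>: "dfn (\<lambda>e. \<rho> (block (e 0)) (block (e 1)))"
    and inf: "infinite {m \<in> carrier H. infinite {x \<in> carrier H. \<rho> m x}}" (is "infinite ?M")
  obtains x where "x \<in> carrier H" "infinite {m \<in> carrier H. \<rho> m x}"
proof -
  have "?M = (\<Union>j\<in>{..<n}. {m \<in> ?M. infinite ((\<lambda>x. x ! j) ` {x \<in> carrier H. \<rho> m x})})"
  proof (intro equalityI subsetI)
    fix m assume m: "m \<in> ?M"
    then obtain j where "j < n" "infinite ((\<lambda>x. x ! j) ` {x \<in> carrier H. \<rho> m x})"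
      using infinite_coordinate[of "{x \<in> carrier H. \<rho> m x}" n] length_carrier by auto
    then show "m \<in> (\<Union>j\<in>{..<n}. {m \<in> ?M. infinite ((\<lambda>x. x ! j) ` {x \<in> carrier H. \<rho> m x})})" using m by auto
  qed auto
  then obtain j where j: "j < n" "infinite {m \<in> ?M. infinite ((\<lambda>x. x ! j) ` {x \<in> carrier H. \<rho> m x})}"
    (is "infinite ?Mj")
    using inf by (metis (no_types, lifting) finite_UN_I finite_lessThan lessThan_iff)
  then obtain i where i: "i < n" "infinite ((\<lambda>m. m ! i) ` ?Mj)"
    using infinite_coordinate[OF j(2), of n] length_carrier by auto
  define Z where "Z u v \<longleftrightarrow> (\<exists>m\<in>carrier H. \<exists>x\<in>carrier H. m ! i = u \<and> x ! j = v \<and> \<rho> m x)" for u v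
  have "dfn (\<lambda>e. Z (e 0 0) (e 1 0))"
    unfolding Z_def using i(1) j(1) by (intro carrier_rules dfn_term_nth dfn_subst_vec2[OF \<rho>]) auto
  moreover have "infinite {u. infinite {v. Z u v}}"
  proof (rule infinite_super[OF _ i(2)], rule subsetI)
    fix u assume "u \<in> (\<lambda>m. m ! i) ` ?Mj"
    then obtain m where m: "m \<in> carrier H" "m ! i = u" "infinite ((\<lambda>x. x ! j) ` {x \<in> carrier H. \<rho> m x})"
      by auto
    have "(\<lambda>x. x ! j) ` {x \<in> carrier H. \<rho> m x} \<subseteq> {v. Z u v}" using m(1,2) by (auto simp: Z_def)
    then show "u \<in> {u. infinite {v. Z u v}}" using m(3) infinite_super by blast
  qed
  ultimately obtain a b c d where box: "a < b" "c < d"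
    "\<And>u v. a < u \<Longrightarrow> u < b \<Longrightarrow> c < v \<Longrightarrow> v < d \<Longrightarrow> Z u v"
    using exists_open_box[where Z = Z] by blast
  \<comment> \<open>A height \<open>v\<close> of the box is chosen off the finitely many bad values,
    so only finitely many elements of \<open>H\<close> lie over it.\<close>
  have "infinite ({c<..<d} - {v. infinite {x \<in> carrier H. x ! j = v}})"
    using infinite_Ioo[OF box(2)] finite_bad_coordinates[OF j(1)] by (rule Diff_infinite_finite[rotated])
  then obtain v where v: "c < v" "v < d" "finite {x \<in> carrier H. x ! j = v}"
    by (metis (no_types, lifting) DiffE finite.emptyI ex_in_conv greaterThanLessThan_iff mem_Collect_eq)
  let ?X = "{x \<in> carrier H. x ! j = v}"
  have "{a<..<b} \<subseteq> (\<Union>x\<in>?X. (\<lambda>m. m ! i) ` {m \<in> carrier H. \<rho> m x})"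
    using box(3) v(1,2) unfolding Z_def by fastforce
  then have "\<not> finite (\<Union>x\<in>?X. (\<lambda>m. m ! i) ` {m \<in> carrier H. \<rho> m x})"
    using infinite_Ioo[OF box(1)] finite_subset by blast
  then obtain x where "x \<in> ?X" "infinite ((\<lambda>m. m ! i) ` {m \<in> carrier H. \<rho> m x})"
    using v(3) by (meson finite_UN_I)
  then show ?thesis using that finite_imageI by blast
qed

text \<open>An infinite directed set has infinite up-sets, which finite down-sets make a point-finite family.\<close>

lemma finite_directed:
  assumes "I \<subseteq> carrier H" "dfn (\<lambda>e. block (e 0) \<in> I)" "dfn (\<lambda>e. r (block (e 0)) (block (e 1)))"
    and "\<And>c. c \<in> I \<Longrightarrow> finite {b \<in> I. r b c}"
    and "\<And>b c. b \<in> I \<Longrightarrow> c \<in> I \<Longrightarrow> \<exists>d\<in>I. r b d \<and> r c d"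
  shows "finite I"
proof (rule ccontr)
  assume inf: "infinite I"
  let ?\<rho> = "\<lambda>b c. b \<in> I \<and> c \<in> I \<and> r b c"
  have I: "dfn (\<lambda>e. t e \<in> I)" if "vec_term t" for t
    by (rule dfn_subst_vec2[where X = "\<lambda>x y. x \<in> I", OF assms(2) that that])
  have \<rho>: "dfn (\<lambda>e. ?\<rho> (block (e 0)) (block (e 1)))"
    by (intro carrier_rules I assms(3))
  have up: "infinite {c \<in> carrier H. ?\<rho> b c}" if b: "b \<in> I" for b
  proof
    assume "finite {c \<in> carrier H. ?\<rho> b c}"
    \<comment> \<open>By directedness every \<open>c\<close> lies below some \<open>d\<close> above
      \<open>b\<close>, so a finite up-set of \<open>b\<close> would cover \<open>I\<close> by
      finitely many finite down-sets.\<close>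
    moreover have "I \<subseteq> (\<Union>d\<in>{c \<in> carrier H. ?\<rho> b c}. {c \<in> I. r c d})"
    proof
      fix c assume "c \<in> I"
      then obtain d where "d \<in> I" "r b d" "r c d" using assms(5) b by blast
      then show "c \<in> (\<Union>d\<in>{c \<in> carrier H. ?\<rho> b c}. {c \<in> I. r c d})" using \<open>c \<in> I\<close> b assms(1) by blast
    qed
    ultimately show False using inf assms(4) by (metis (no_types, lifting) finite_UN_I finite_subset mem_Collect_eq)
  qed
  have "infinite {m \<in> carrier H. infinite {x \<in> carrier H. ?\<rho> m x}}"
    by (rule infinite_super[OF _ inf]) (use up assms(1) in auto)
  from infinite_family_overlaps[OF \<rho> this]
  obtain x where x: "infinite {m \<in> carrier H. ?\<rho> m x}" by blast
  then obtain m where "?\<rho> m x" by (metis (no_types, lifting) finite.emptyI Collect_empty_eq)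
  then have "finite {b \<in> I. r b x}" using assms(4) by blast
  moreover have "{m \<in> carrier H. ?\<rho> m x} \<subseteq> {b \<in> I. r b x}" by blast
  ultimately show False using x finite_subset by blast
qed

text \<open>Expresses implication through the order alone, the only relation whose definability is
  given. The same is done for joins next.\<close>

lemma eq_imp_iff:
  assumes "m \<in> carrier H" "y \<in> carrier H" "x \<in> carrier H"
  shows "m = y \<rightharpoonup> x \<longleftrightarrow> (\<forall>z\<in>carrier H. leq z m \<longleftrightarrow> (\<forall>t\<in>carrier H. leq t z \<and> leq t y \<longrightarrow> leq t x))" (is "_ = ?r")
proof -
  have *: "(\<forall>t\<in>carrier H. leq t z \<and> leq t y \<longrightarrow> leq t x) \<longleftrightarrow> z \<sqsubseteq> y \<rightharpoonup> x" if "z \<in> carrier H" for z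
  proof -
    have "(\<forall>t\<in>carrier H. t \<sqsubseteq> z \<and> t \<sqsubseteq> y \<longrightarrow> t \<sqsubseteq> x) \<longleftrightarrow> z \<sqinter> y \<sqsubseteq> x"
      using that assms meet_left[of z y] meet_right[of z y] le_trans[of _ "z \<sqinter> y" x] by (metis le_meet_iff meet_closed)
    then show ?thesis using that assms by (simp add: leq_def le_imp_iff)
  qed
  have "?r \<longleftrightarrow> (\<forall>z\<in>carrier H. z \<sqsubseteq> m \<longleftrightarrow> z \<sqsubseteq> y \<rightharpoonup> x)" using * assms by (simp add: leq_def)
  also have "\<dots> \<longleftrightarrow> m = y \<rightharpoonup> x" using assms by (metis imp_closed le_antisym le_refl)
  finally show ?thesis by simp
qed

lemma eq_join_iff:
  assumes "w \<in> carrier H" "u \<in> carrier H" "v \<in> carrier H"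
  shows "w = u \<squnion> v \<longleftrightarrow> (\<forall>z\<in>carrier H. leq w z \<longleftrightarrow> leq u z \<and> leq v z)" (is "_ = ?r")
proof -
  have "?r \<longleftrightarrow> (\<forall>z\<in>carrier H. w \<sqsubseteq> z \<longleftrightarrow> u \<squnion> v \<sqsubseteq> z)" using assms by (simp add: leq_def)
  also have "\<dots> \<longleftrightarrow> w = u \<squnion> v" using assms by (metis join_closed le_antisym le_refl)
  finally show ?thesis by simp
qed

lemma dfn_eq_imp:
  assumes "vec_term m" "vec_term y" "vec_term x"
  shows "dfn (\<lambda>e. m e \<in> carrier H \<and> y e \<in> carrier H \<and> x e \<in> carrier H \<and> m e = y e \<rightharpoonup> x e)"
proof -
  have "dfn (\<lambda>e. block (e 0) \<in> carrier H \<and> block (e 1) \<in> carrier H \<and> block (e 2) \<in> carrier H \<and>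
    (\<forall>z\<in>carrier H. leq z (block (e 0)) \<longleftrightarrow>
      (\<forall>t\<in>carrier H. leq t z \<and> leq t (block (e 1)) \<longrightarrow> leq t (block (e 2)))))"
    by (intro carrier_rules)
  from dfn_subst_vec3[where X = "\<lambda>m y x. m \<in> carrier H \<and> y \<in> carrier H \<and> x \<in> carrier H \<and>
    (\<forall>z\<in>carrier H. leq z m \<longleftrightarrow> (\<forall>t\<in>carrier H. leq t z \<and> leq t y \<longrightarrow> leq t x))", OF this assms]
  show ?thesis using eq_imp_iff by (simp cong: conj_cong)
qed

lemma dfn_eq_join:
  assumes "vec_term w" "vec_term u" "vec_term v"
  shows "dfn (\<lambda>e. w e \<in> carrier H \<and> u e \<in> carrier H \<and> v e \<in> carrier H \<and> w e = u e \<squnion> v e)"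
proof -
  have "dfn (\<lambda>e. block (e 0) \<in> carrier H \<and> block (e 1) \<in> carrier H \<and> block (e 2) \<in> carrier H \<and>
    (\<forall>z\<in>carrier H. leq (block (e 0)) z \<longleftrightarrow> leq (block (e 1)) z \<and> leq (block (e 2)) z))"
    by (intro carrier_rules)
  from dfn_subst_vec3[where X = "\<lambda>w u v. w \<in> carrier H \<and> u \<in> carrier H \<and> v \<in> carrier H \<and>
    (\<forall>z\<in>carrier H. leq w z \<longleftrightarrow> leq u z \<and> leq v z)", OF this assms]
  show ?thesis using eq_join_iff by (simp cong: conj_cong)
qed

text \<open>Membership in \<open>regulars x\<close> with both arguments variable: it serves with
  \<open>x\<close> fixed, and also as a family of sets of \<open>x\<close> indexed by
  \<open>m\<close>.\<close>

definition reg_rel :: "'a list \<Rightarrow> 'a list \<Rightarrow> bool" where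
  "reg_rel m x \<longleftrightarrow> (\<exists>y\<in>carrier H. m \<in> carrier H \<and> y \<in> carrier H \<and> x \<in> carrier H \<and> m = y \<rightharpoonup> x)"

lemma reg_rel_iff: "x \<in> carrier H \<Longrightarrow> reg_rel m x \<longleftrightarrow> m \<in> regulars x"
  by (auto simp: reg_rel_def regulars_def)

lemma dfn_reg_rel:
  assumes "vec_term s" "vec_term t"
  shows "dfn (\<lambda>e. reg_rel (s e) (t e))"
proof -
  have "dfn (\<lambda>e. reg_rel (block (e 0)) (block (e 1)))"
    unfolding reg_rel_def by (intro dfn_ex_carrier dfn_eq_imp vec_term_block)
  from dfn_subst_vec2[OF this assms] show ?thesis .
qed

text \<open>For \<open>u\<close> below \<open>b\<close> and \<open>v\<close> below its complement,
  \<open>u \<squnion> v\<close> determines both: the part of \<open>v\<close> inside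
  \<open>b\<close> lies below \<open>x \<sqsubseteq> u\<close>, so
  \<open>u = (u \<squnion> v) \<sqinter> b\<close>, and symmetrically for \<open>v\<close>. The sets
  of all \<open>u \<squnion> v\<close> with \<open>u\<close> fixed would thus be infinitely many
  disjoint infinite sets. The join of \<open>H\<close> is taken, which need not be regular.\<close>

lemma regulars_split_finite:
  assumes x: "x \<in> carrier H" and b: "b \<in> regulars x"
    and inf: "infinite {m \<in> regulars x. m \<sqsubseteq> b}" "infinite {m \<in> regulars x. m \<sqsubseteq> b \<rightharpoonup> x}"
  shows False
proof -
  have c: "m \<in> carrier H" if "m \<in> regulars x" for m using that x regulars_closed by blast
  let ?b = "b \<rightharpoonup> x"
  have bc: "b \<in> carrier H" "?b \<in> carrier H" using b c x by simp_all
  have b_inter: "u \<sqsubseteq> x" if "u \<in> carrier H" "u \<sqsubseteq> b" "u \<sqsubseteq> ?b" for u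
    using that bc x imp_meet_le[of b x] le_trans[of u "?b \<sqinter> b" x] by simp
  define \<rho> where "\<rho> u w \<longleftrightarrow> (\<exists>v\<in>carrier H. reg_rel u x \<and> reg_rel v x \<and> leq u b \<and> leq v ?b \<and>
    (w \<in> carrier H \<and> u \<in> carrier H \<and> v \<in> carrier H \<and> w = u \<squnion> v))" for u w
  have "dfn (\<lambda>e. \<rho> (block (e 0)) (block (e 1)))"
    unfolding \<rho>_def using x bc
    by (intro dfn_ex_carrier dfn_conj dfn_reg_rel dfn_leq dfn_eq_join vec_term_block vec_term_const length_carrier)
  have "infinite {w \<in> carrier H. \<rho> u w}" if u: "u \<in> regulars x" "u \<sqsubseteq> b" for u
  proof -
    have "u \<squnion> v \<in> carrier H \<and> \<rho> u (u \<squnion> v)" if "v \<in> regulars x" "v \<sqsubseteq> ?b" for v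
      using that u c x bc by (auto simp: \<rho>_def reg_rel_iff leq_def)
    then have "(\<lambda>v. u \<squnion> v) ` {m \<in> regulars x. m \<sqsubseteq> ?b} \<subseteq> {w \<in> carrier H. \<rho> u w}" by auto
    moreover have "(u \<squnion> v) \<sqinter> ?b = v" if v: "v \<in> regulars x" "v \<sqsubseteq> ?b" for v
    proof -
      have cs: "u \<in> carrier H" "v \<in> carrier H" using u v c by auto
      have "u \<sqinter> ?b \<sqsubseteq> x"
        using b_inter[of "u \<sqinter> ?b"] cs bc u(2) by (simp add: meet_le_left meet_right)
      then have "u \<sqinter> ?b \<sqsubseteq> v" using le_regular[OF x v(1)] cs bc x by (meson le_trans meet_closed)
      moreover have "(u \<squnion> v) \<sqinter> ?b = (u \<sqinter> ?b) \<squnion> (v \<sqinter> ?b)"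
        using cs bc by (intro meet_join_distrib_right)
      ultimately show ?thesis using cs bc v(2) by (simp add: absorb)
    qed
    then have "inj_on (\<lambda>v. u \<squnion> v) {m \<in> regulars x. m \<sqsubseteq> ?b}"
      by (intro inj_on_inverseI[where g = "\<lambda>w. w \<sqinter> ?b"]) auto
    then have "infinite ((\<lambda>v. u \<squnion> v) ` {m \<in> regulars x. m \<sqsubseteq> ?b})"
      using inf(2) finite_imageD by blast
    ultimately show ?thesis by (rule infinite_super)
  qed
  then have "infinite {u \<in> carrier H. infinite {w \<in> carrier H. \<rho> u w}}"
    by (intro infinite_super[OF _ inf(1)]) (use c in auto)
  from infinite_family_overlaps[OF \<open>dfn _\<close> this]
  obtain w where w: "w \<in> carrier H" "infinite {u \<in> carrier H. \<rho> u w}" by blast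
  have "u = w \<sqinter> b" if "\<rho> u w" for u
  proof -
    obtain v where v: "v \<in> regulars x" "u \<in> regulars x" "u \<sqsubseteq> b" "v \<sqsubseteq> ?b" "w = u \<squnion> v"
      using \<open>\<rho> u w\<close> x by (auto simp: \<rho>_def reg_rel_iff leq_def)
    have cs: "u \<in> carrier H" "v \<in> carrier H" using v c by auto
    have "v \<sqinter> b \<sqsubseteq> x"
      using b_inter[of "v \<sqinter> b"] cs bc v(4) by (simp add: meet_le_left meet_right)
    then have "v \<sqinter> b \<sqsubseteq> u" using le_regular[OF x v(2)] cs bc x by (meson le_trans meet_closed)
    moreover have "(u \<squnion> v) \<sqinter> b = (u \<sqinter> b) \<squnion> (v \<sqinter> b)"
      using cs bc by (intro meet_join_distrib_right)
    ultimately show ?thesis using cs bc v(3,5) by (simp add: absorb)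
  qed
  then have "{u \<in> carrier H. \<rho> u w} \<subseteq> {w \<sqinter> b}" by blast
  then show False using w(2) finite_subset by blast
qed

text \<open>If the algebra is infinite, exactly one of \<open>b\<close> and its complement has
  finitely many predecessors: at least one by \<open>regulars_split_finite\<close>, not both by
  \<open>finite_regularsI\<close>. So \<open>?I\<close> behaves like a maximal ideal and, with the
  complements of its elements, exhausts the algebra; its finiteness is the contradiction.\<close>

lemma finite_regulars:
  assumes x: "x \<in> carrier H"
  shows "finite (regulars x)"
proof (rule ccontr)
  assume inf: "infinite (regulars x)"
  have c: "m \<in> carrier H" if "m \<in> regulars x" for m using that x regulars_closed by blast
  let ?I = "{b \<in> regulars x. finite {m \<in> regulars x. m \<sqsubseteq> b}}"
  have dichotomy: "b \<in> ?I \<longleftrightarrow> b \<rightharpoonup> x \<notin> ?I" if "b \<in> regulars x" for b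
    using that regulars_split_finite[OF x that] finite_regularsI[OF x that] inf imp_in_regulars c by blast
  have "finite ?I"
  proof (rule finite_directed)
    show "?I \<subseteq> carrier H" using c by blast
    have "dfn (\<lambda>e. reg_rel (block (e 0)) x \<and> \<not> infinite {m \<in> carrier H. reg_rel m x \<and> leq m (block (e 0))})"
      using x by (intro dfn_conj dfn_not dfn_infinite dfn_reg_rel dfn_leq vec_term_block vec_term_const length_carrier)
    moreover have "reg_rel b x \<and> \<not> infinite {m \<in> carrier H. reg_rel m x \<and> leq m b} \<longleftrightarrow> b \<in> ?I" for b
    proof -
      have "{m \<in> carrier H. reg_rel m x \<and> leq m b} = {m \<in> regulars x. m \<sqsubseteq> b}" if "b \<in> regulars x"
        using x c that by (auto simp: reg_rel_iff leq_def)
      then show ?thesis using x by (auto simp: reg_rel_iff)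
    qed
    ultimately show "dfn (\<lambda>e. block (e 0) \<in> ?I)" by simp
    show "dfn (\<lambda>e. leq (block (e 0)) (block (e 1)))" by (intro dfn_leq vec_term_block)
    show "finite {b \<in> ?I. leq b d}" if "d \<in> ?I" for d
      by (rule finite_subset[of _ "{m \<in> regulars x. m \<sqsubseteq> d}"]) (use that in \<open>auto simp: leq_def\<close>)
    show "\<exists>d\<in>?I. leq b d \<and> leq b' d" if b: "b \<in> ?I" "b' \<in> ?I" for b b'
    proof (intro bexI conjI)
      let ?d = "((b \<squnion> b') \<rightharpoonup> x) \<rightharpoonup> x"
      have cs: "b \<in> carrier H" "b' \<in> carrier H" using b c by auto
      show "?d \<in> ?I" using finite_regulars_below_join[OF x] b imp_in_regulars cs x by simp
      have "b \<squnion> b' \<sqsubseteq> ?d" using le_imp_imp cs x by simp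
      then show "leq b ?d" "leq b' ?d" using cs x by (simp_all add: leq_def)
    qed
  qed
  moreover have "regulars x \<subseteq> ?I \<union> (\<lambda>b. b \<rightharpoonup> x) ` ?I"
  proof
    fix b assume b: "b \<in> regulars x"
    then have "b = (b \<rightharpoonup> x) \<rightharpoonup> x" using regulars_imp_imp x by simp
    then show "b \<in> ?I \<union> (\<lambda>b. b \<rightharpoonup> x) ` ?I" using dichotomy[OF b] by blast
  qed
  ultimately show False using inf by (meson finite_UnI finite_imageI finite_subset)
qed

text \<open>For \<open>m\<close> in \<open>?W\<close> every \<open>x\<close> in the infinite
  interval satisfies \<open>m = y \<rightharpoonup> x\<close>, so \<open>m\<close> is regular over
  infinitely many \<open>x\<close>. By \<open>finite_regulars\<close> no single \<open>x\<close>
  serves infinitely many \<open>m\<close>.\<close>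

lemma finite_exceptional:
  "finite {m \<in> carrier H. \<exists>y\<in>carrier H. y \<rightharpoonup> m = m \<and> infinite (interval (m \<sqinter> y) m)}" (is "finite ?W")
proof (rule ccontr)
  assume inf: "infinite ?W"
  have dfn: "dfn (\<lambda>e. reg_rel (block (e 0)) (block (e 1)))" by (intro dfn_reg_rel vec_term_block)
  have "infinite {x \<in> carrier H. reg_rel m x}" if "m \<in> ?W" for m
  proof -
    obtain y where y: "m \<in> carrier H" "y \<in> carrier H" "y \<rightharpoonup> m = m" "infinite (interval (m \<sqinter> y) m)"
      using \<open>m \<in> ?W\<close> by blast
    \<comment> \<open>From \<open>x \<sqsubseteq> m\<close> follows \<open>y \<rightharpoonup> x
      \<sqsubseteq> y \<rightharpoonup> m = m\<close>; the converse only needs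
      \<open>m \<sqinter> y \<sqsubseteq> x\<close>.\<close>
    have imp_eq: "y \<rightharpoonup> x = m" if x: "x \<in> interval (m \<sqinter> y) m" for x
    proof (rule le_antisym)
      have x': "x \<in> carrier H" "m \<sqinter> y \<sqsubseteq> x" "x \<sqsubseteq> m" using x by (auto simp: interval_def)
      have "(y \<rightharpoonup> x) \<sqinter> y \<sqsubseteq> m"
        using imp_meet_le[of y x] x' y by (meson imp_closed le_trans meet_closed)
      then show "y \<rightharpoonup> x \<sqsubseteq> m" using le_imp_iff[of y m "y \<rightharpoonup> x"] x' y by simp
      show "m \<sqsubseteq> y \<rightharpoonup> x" using x' y by (simp add: le_imp_iff)
    qed (use x y in \<open>auto simp: interval_def\<close>)
    have "interval (m \<sqinter> y) m \<subseteq> {x \<in> carrier H. reg_rel m x}"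
    proof
      fix x assume x: "x \<in> interval (m \<sqinter> y) m"
      then have "x \<in> carrier H" by (simp add: interval_def)
      then show "x \<in> {x \<in> carrier H. reg_rel m x}"
        unfolding reg_rel_def using y(1,2) imp_eq[OF x] by blast
    qed
    then show ?thesis using y(4) finite_subset by blast
  qed
  then have "infinite {m \<in> carrier H. infinite {x \<in> carrier H. reg_rel m x}}"
    by (intro infinite_super[OF _ inf]) auto
  from infinite_family_overlaps[OF dfn this]
  obtain x where x: "x \<in> carrier H" "infinite {m \<in> carrier H. reg_rel m x}" by blast
  have "{m \<in> carrier H. reg_rel m x} \<subseteq> regulars x" using x(1) by (auto simp: reg_rel_iff)
  then show False using x finite_regulars finite_subset by blast
qed

text \<open>The set is directed by joins, since \<open>[l, b \<squnion> c]\<close> is glued from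
  \<open>[l, c]\<close> and a translate of \<open>[l, b]\<close>. Its down-sets lie in the finite
  intervals \<open>[l, d]\<close>.\<close>

lemma finite_above_near:
  assumes l: "l \<in> carrier H"
  shows "finite {g \<in> carrier H. l \<sqsubseteq> g \<and> finite (interval l g)}" (is "finite ?I")
proof (rule finite_directed)
  have "dfn (\<lambda>e. leq l (block (e 0)) \<and> \<not> infinite {m \<in> carrier H. leq l m \<and> leq m (block (e 0))})"
    using l by (intro dfn_conj dfn_not dfn_infinite dfn_leq vec_term_block vec_term_const length_carrier)
  moreover have "leq l g \<and> \<not> infinite {m \<in> carrier H. leq l m \<and> leq m g} \<longleftrightarrow> g \<in> ?I" for g
    using l by (auto simp: leq_def interval_def cong: conj_cong)
  ultimately show "dfn (\<lambda>e. block (e 0) \<in> ?I)" by simp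
  show "dfn (\<lambda>e. leq (block (e 0)) (block (e 1)))" by (intro dfn_leq vec_term_block)
  show "finite {b \<in> ?I. leq b d}" if "d \<in> ?I" for d
    by (rule finite_subset[of _ "interval l d"]) (use that in \<open>auto simp: leq_def interval_def\<close>)
  show "\<exists>d\<in>?I. leq b d \<and> leq c d" if "b \<in> ?I" "c \<in> ?I" for b c
  proof (intro bexI conjI)
    have bc: "b \<in> carrier H" "c \<in> carrier H" "l \<sqsubseteq> b" "l \<sqsubseteq> c" "finite (interval l b)" "finite (interval l c)"
      using that by auto
    have "finite (interval (l \<squnion> c) (b \<squnion> c))" using bc l by (intro finite_interval_join)
    then have "finite (interval c (b \<squnion> c))" using bc l by (simp add: absorb)
    then have "finite (interval l (b \<squnion> c))"
      using bc l by (intro finite_interval_trans[of l c "b \<squnion> c"]) (simp_all add: join_right)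
    then show "b \<squnion> c \<in> ?I" using bc l by (simp add: le_join_left)
    show "leq b (b \<squnion> c)" "leq c (b \<squnion> c)" using bc by (simp_all add: leq_def join_left join_right)
  qed
qed auto

lemma finite_below_near:
  assumes l: "l \<in> carrier H"
  shows "finite {g \<in> carrier H. g \<sqsubseteq> l \<and> finite (interval g l)}" (is "finite ?I")
proof (rule finite_directed)
  have "dfn (\<lambda>e. leq (block (e 0)) l \<and> \<not> infinite {m \<in> carrier H. leq (block (e 0)) m \<and> leq m l})"
    using l by (intro dfn_conj dfn_not dfn_infinite dfn_leq vec_term_block vec_term_const length_carrier)
  moreover have "leq g l \<and> \<not> infinite {m \<in> carrier H. leq g m \<and> leq m l} \<longleftrightarrow> g \<in> ?I" for g
    using l by (auto simp: leq_def interval_def cong: conj_cong)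
  ultimately show "dfn (\<lambda>e. block (e 0) \<in> ?I)" by simp
  \<comment> \<open>The arguments are swapped: this set is directed downwards, by meets.\<close>
  show "dfn (\<lambda>e. leq (block (e 1)) (block (e 0)))" by (intro dfn_leq vec_term_block)
  show "finite {b \<in> ?I. leq d b}" if "d \<in> ?I" for d
    by (rule finite_subset[of _ "interval d l"]) (use that in \<open>auto simp: leq_def interval_def\<close>)
  show "\<exists>d\<in>?I. leq d b \<and> leq d c" if "b \<in> ?I" "c \<in> ?I" for b c
  proof (intro bexI conjI)
    have bc: "b \<in> carrier H" "c \<in> carrier H" "b \<sqsubseteq> l" "c \<sqsubseteq> l" "finite (interval b l)" "finite (interval c l)"
      using that by auto
    have "finite (interval (b \<sqinter> c) (l \<sqinter> c))" using bc l by (intro finite_interval_meet)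
    then have "finite (interval (b \<sqinter> c) c)" using bc l by (simp add: absorb)
    then have "finite (interval (b \<sqinter> c) l)"
      using bc l by (intro finite_interval_trans[of "b \<sqinter> c" c l]) (simp_all add: meet_right)
    then show "b \<sqinter> c \<in> ?I" using bc l by (simp add: meet_le_left)
    show "leq (b \<sqinter> c) b" "leq (b \<sqinter> c) c" using bc by (simp_all add: leq_def meet_left meet_right)
  qed
qed auto

lemma finite_near_class:
  assumes l: "l \<in> carrier H"
  shows "finite {g \<in> carrier H. near g l}" (is "finite ?C")
proof (rule inj_on_finite)
  let ?f = "\<lambda>g. (g \<sqinter> l, g \<squnion> l)"
  show "inj_on ?f ?C" using l by (intro inj_onI) (auto intro: distributive_cancel)
  show "?f ` ?C \<subseteq> {g \<in> carrier H. g \<sqsubseteq> l \<and> finite (interval g l)} \<times> {g \<in> carrier H. l \<sqsubseteq> g \<and> finite (interval l g)}"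
  proof (rule image_subsetI)
    fix g assume "g \<in> ?C"
    then have g: "g \<in> carrier H" "finite (interval (g \<sqinter> l) (g \<squnion> l))" by (auto simp: near_def)
    have "finite (interval (g \<sqinter> l) l)" "finite (interval l (g \<squnion> l))"
      using g l by (auto intro!: finite_subset[OF interval_mono g(2)] simp: order_simps)
    then show "?f g \<in> {g \<in> carrier H. g \<sqsubseteq> l \<and> finite (interval g l)} \<times> {g \<in> carrier H. l \<sqsubseteq> g \<and> finite (interval l g)}"
      using g l by (simp add: meet_right join_right)
  qed
qed (use l finite_above_near finite_below_near in simp)

theorem locally_finite: "locally_finite H"
  unfolding locally_finite_def
proof (intro allI impI, elim conjE)
  fix S assume S: "finite S" "S \<subseteq> carrier H"
  let ?W = "{m \<in> carrier H. \<exists>y\<in>carrier H. y \<rightharpoonup> m = m \<and> infinite (interval (m \<sqinter> y) m)}"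
  obtain K where K: "sublattice K" "finite K" "S \<union> ?W \<subseteq> K"
    using finite_sublattice_exists[of "S \<union> ?W"] S finite_exceptional by auto
  have Kc: "\<And>k. k \<in> K \<Longrightarrow> k \<in> carrier H" and K_mem: "\<bottom> \<in> K" "\<top> \<in> K"
    and K_ops: "\<And>k l. k \<in> K \<Longrightarrow> l \<in> K \<Longrightarrow> k \<sqinter> l \<in> K \<and> k \<squnion> l \<in> K"
    using K(1) unfolding sublattice_def by blast+
  let ?A = "{g \<in> carrier H. \<exists>k\<in>K. near g k}"
  have K_sub: "K \<subseteq> ?A" using Kc near_refl by blast
  have imp_near: "y \<rightharpoonup> x \<in> ?W \<or> near (y \<rightharpoonup> x) x" if "x \<in> carrier H" "y \<in> carrier H" for x y
  proof (rule disjCI)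
    \<comment> \<open>The antecedent \<open>y\<close> is replaced by \<open>x \<squnion> y\<close>
      because then \<open>?m \<sqinter> ?b\<close> is exactly \<open>x\<close>, while
      \<open>?b \<rightharpoonup> ?m = ?m\<close> still holds. The interval that decides whether
      \<open>?m\<close> is exceptional becomes \<open>[x, ?m]\<close>, the one that decides
      nearness.\<close>
    let ?m = "y \<rightharpoonup> x" and ?b = "x \<squnion> y"
    assume "\<not> near ?m x"
    have x_le: "x \<sqsubseteq> ?m" using that by (simp add: le_imp_self)
    have "?m \<sqinter> ?b = (?m \<sqinter> x) \<squnion> (?m \<sqinter> y)" using that by (intro meet_join_distrib) auto
    also have "?m \<sqinter> x = x" using that x_le by (intro absorb) auto
    also have "x \<squnion> (?m \<sqinter> y) = x" using that imp_meet_le[of y x] by (simp add: absorb)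
    finally have meet: "?m \<sqinter> ?b = x" .
    have "?b \<rightharpoonup> ?m = ?m"
    proof (rule le_antisym)
      let ?d = "?b \<rightharpoonup> ?m"
      have dc: "?d \<in> carrier H" using that by simp
      have "?d \<sqinter> y \<sqsubseteq> ?d \<sqinter> ?b" using that by (intro meet_mono) (simp_all add: join_right)
      then have "?d \<sqinter> y \<sqsubseteq> ?m" using imp_meet_le[of ?b ?m] that by (meson imp_closed join_closed le_trans meet_closed)
      then have "?d \<sqinter> y \<sqsubseteq> ?m \<sqinter> y" using that dc by (simp add: meet_right)
      then have "?d \<sqinter> y \<sqsubseteq> x" using imp_meet_le[of y x] that dc by (meson imp_closed le_trans meet_closed)
      then show "?d \<sqsubseteq> ?m" using that dc by (simp add: le_imp_iff)
      show "?m \<sqsubseteq> ?d" using that by (intro le_imp_self) auto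
    qed (use that in auto)
    moreover have "?m \<sqinter> x = x" "?m \<squnion> x = ?m" using that x_le by (auto intro: absorb)
    then have "infinite (interval (?m \<sqinter> ?b) ?m)"
      using \<open>\<not> near ?m x\<close> by (simp only: near_def meet not_False_eq_True)
    moreover have "?b \<in> carrier H" "?m \<in> carrier H" using that by simp_all
    ultimately show "?m \<in> ?W" by blast
  qed
  have "heyting_subalgebra H ?A"
    unfolding heyting_subalgebra_def
  proof (intro conjI ballI)
    show "\<bottom> \<in> ?A" "\<top> \<in> ?A" using K_sub K_mem by blast+
    fix x y assume xy: "x \<in> ?A" "y \<in> ?A"
    then obtain k l where kl: "k \<in> K" "l \<in> K" "near x k" "near y l" by blast
    have c: "x \<in> carrier H" "y \<in> carrier H" "k \<in> carrier H" "l \<in> carrier H" using xy kl Kc by auto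
    show "x \<sqinter> y \<in> ?A" using near_meet[OF kl(3,4)] c K_ops[OF kl(1,2)] by auto
    show "x \<squnion> y \<in> ?A" using near_join[OF kl(3,4)] c K_ops[OF kl(1,2)] by auto
    \<comment> \<open>An exceptional value is already in \<open>K\<close>; any other value is near
      the consequent \<open>y\<close> and hence near \<open>l\<close>.\<close>
    show "x \<rightharpoonup> y \<in> ?A"
      using imp_near[OF c(2,1)]
    proof
      assume "x \<rightharpoonup> y \<in> ?W"
      then show ?thesis using K(3) K_sub by blast
    next
      assume "near (x \<rightharpoonup> y) y"
      then have "near (x \<rightharpoonup> y) l" using near_trans kl(4) c by simp
      then show ?thesis using kl(2) c by auto
    qed
  qed auto
  moreover have "S \<subseteq> ?A" using K(3) K_sub by blast
  ultimately have "generated_subalgebra H S \<subseteq> ?A" unfolding generated_subalgebra_def by blast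
  moreover have "?A = (\<Union>k\<in>K. {g \<in> carrier H. near g k})" by blast
  then have "finite ?A" using K(2) Kc finite_near_class by simp
  ultimately show "finite (generated_subalgebra H S)" by (rule finite_subset)
qed

end

theorem proposition4p4:
  fixes F :: "'f \<Rightarrow> 'a list \<Rightarrow> 'a::linordered_field"
    and P :: "'r \<Rightarrow> 'a list \<Rightarrow> bool"
    and n :: nat
    and H :: "'a list gorder"
  assumes "real_closed TYPE('a)"
    and "o_minimal F P"
    and "definable_heyting_algebra F P n H"
    and "o_dim n (carrier H) = 1"
  shows "locally_finite H"
proof -
  interpret definable_heyting_dim_one F P n H
    using assms(2-4) by unfold_locales
  show ?thesis by (rule locally_finite)
qed

end
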